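(* Consider the single-client model described in the context, with memory capacity $k$ per class, and let $\delta\in(0,1)$. With probability at least $1-\delta$ over the $N$ observed test samples, for all sufficiently large $N$, $$\epsilon_{\mathrm{post}}\le \epsilon_{\mathrm{asym}}+\mathcal O\!\left(\left(\frac{k+\log\frac1\delta}{N}\right)^{\frac{1}{d+1}}\right).$$ Moreover, if $\epsilon_{\mathrm{asym}}=0$, then with probability at least $1-\delta$, for all sufficiently large $N$, $$\epsilon_{\mathrm{post}}\le \mathcal O\!\left(\left(\frac{k+\log\frac1\delta}{N}\right)^{\frac12}\right).$$ Here the constants hidden in $\mathcal O(\cdot)$ do not depend on $N$, $k$ or $\delta$.
   Context: Fix $d\ge 1$, $\mu\in\mathbb{R}^d$, $w_{\mathrm{pre}}\in\mathbb{R}^d$ with $\|w_{\mathrm{pre}}\|_2=1$, $b_{\mathrm{pre}}\in\mathbb{R}$, and $t>0$. Data model: a label $y$ is uniform on $\{0,1\}$ and, given $y$, the embedding $f\in\mathbb{R}^d$ is uniform on the closed unit ball $S_y=\{f:\|f-(2y-1)\mu\|_2\le 1\}$. Initial classifier: $z(f)=f^\top w_{\mathrm{pre}}+b_{\mathrm{pre}}$, $\hat p_1=1/(1+e^{-t z(f)})$, $\hat p_0=1-\hat p_1$, predicted label $\hat y(f)=\mathbf 1\{z(f)>0\}$, entropy $H(f)=-\hat p_1\log\hat p_1-\hat p_0\log\hat p_0$. For a classifier $h$, $\epsilon(h)=\Pr(h(f)\neq y)$ for a fresh sample; $\epsilon_{\mathrm{pre}}$ is the error rate of $\hat y$. Assumption: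 $\epsilon_{\mathrm{pre}}<1/2$, equivalently $\mu^\top w_{\mathrm{pre}}>0$ and $-\mu^\top w_{\mathrm{pre}}-1<b_{\mathrm{pre}}<\mu^\top w_{\mathrm{pre}}+1$. Memory: the client observes i.i.d. test embeddings $f_1,\dots,f_N$; for $y\in\{0,1\}$ the memory $M_y$ consists of the (at most) $k$ observed embeddings with $\hat y(f_j)=y$ having the smallest entropy. Post-adaptation classifier (the method with hyperparameters $\alpha,\beta\to+\infty$): $h_{\mathrm{post}}(f)$ is the class of the element of $M_0\cup M_1$ nearest to $f$ in Euclidean distance; $\epsilon_{\mathrm{post}}=\epsilon(h_{\mathrm{post}})$ on a fresh test sample. $\epsilon_{\mathrm{asym}}=\epsilon(h_{\mathrm{asym}})$ with $h_{\mathrm{asym}}(f)=\mathbf 1\{f^\top(\mu+w_{\mathrm{pre}})>0\}$. *)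

theory Defs
  imports "HOL-Probability.Probability"
begin

text \<open>Single-client model. Labels y in {0,1} are encoded as bool (True = 1).
  Embeddings live in a Euclidean space 'a with d = DIM('a).\<close>

definition center :: "'a::euclidean_space \<Rightarrow> bool \<Rightarrow> 'a" where
  "center \<mu> y = (if y then \<mu> else - \<mu>)"

text \<open>Joint law of (f, y): y uniform on {0,1}, f uniform on the closed unit ball
  around (2y-1) mu (density w.r.t. Lebesgue measure times counting measure).\<close>
definition data_dist :: "'a::euclidean_space \<Rightarrow> ('a \<times> bool) measure" where
  "data_dist \<mu> = density (lborel \<Otimes>\<^sub>M count_space UNIV)
     (\<lambda>p. ennreal (indicator (cball (center \<mu> (snd p)) 1) (fst p)
                    / (2 * measure lborel (cball (0::'a) 1))))"

definition err :: "('a \<times> bool) measure \<Rightarrow> ('a \<Rightarrow> bool) \<Rightarrow> real" where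
  "err D h = measure D {p \<in> space D. h (fst p) \<noteq> snd p}"

definition zpre :: "'a::euclidean_space \<Rightarrow> real \<Rightarrow> 'a \<Rightarrow> real" where
  "zpre w b f = inner f w + b"

definition yhat :: "'a::euclidean_space \<Rightarrow> real \<Rightarrow> 'a \<Rightarrow> bool" where
  "yhat w b f = (zpre w b f > 0)"

definition phat1 :: "real \<Rightarrow> 'a::euclidean_space \<Rightarrow> real \<Rightarrow> 'a \<Rightarrow> real" where
  "phat1 t w b f = 1 / (1 + exp (- t * zpre w b f))"

definition entropy :: "real \<Rightarrow> 'a::euclidean_space \<Rightarrow> real \<Rightarrow> 'a \<Rightarrow> real" where
  "entropy t w b f = (let p1 = phat1 t w b f; p0 = 1 - p1 in - p1 * ln p1 - p0 * ln p0)"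

text \<open>Memory M_y: the (at most) k observed embeddings among F 0, ..., F (N-1) with predicted
  label y and smallest entropy (ties, a null event, broken by index). Returned as a set of indices.\<close>
definition memory ::
  "real \<Rightarrow> 'a::euclidean_space \<Rightarrow> real \<Rightarrow> nat \<Rightarrow> nat \<Rightarrow> (nat \<Rightarrow> 'a) \<Rightarrow> bool \<Rightarrow> nat set" where
  "memory t w b k N F y = {j. j < N \<and> yhat w b (F j) = y \<and>
     card {i. i < N \<and> yhat w b (F i) = y \<and>
        (entropy t w b (F i) < entropy t w b (F j) \<or>
         (entropy t w b (F i) = entropy t w b (F j) \<and> i < j))} < k}"

text \<open>Post-adaptation classifier: class of the nearest memory element
  (distance ties, a null event, resolved to class 0).\<close>
definition h_post ::
  "real \<Rightarrow> 'a::euclidean_space \<Rightarrow> real \<Rightarrow> nat \<Rightarrow> nat \<Rightarrow> (nat \<Rightarrow> 'a) \<Rightarrow> 'a \<Rightarrow> bool" where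
  "h_post t w b k N F f = (\<exists>j \<in> memory t w b k N F True.
      \<forall>i \<in> memory t w b k N F False. dist f (F j) < dist f (F i))"

definition h_asym :: "'a::euclidean_space \<Rightarrow> 'a \<Rightarrow> 'a \<Rightarrow> bool" where
  "h_asym \<mu> w f = (inner f (\<mu> + w) > 0)"

end

theory Submission
  imports Defs
begin

text \<open>The entropy is a decreasing function of the distance of an embedding from the initial decision
  hyperplane, so the memory of class y collects the samples that are extreme in the direction w (for y = 1)
  or -w (for y = 0). A cap of height r^2 at the tip of a ball has mass of order r^(d+1) and
  diameter of order r, so by a Chernoff bound it receives k samples as soon as N r^(d+1) is a large multiple of
  k + log(1/delta); then all memory elements are within O(r) of the two tips, which are P and -P for
  P = mu + w. The nearest-element rule now agrees with the sign of the inner product with P unless that inner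
  product is O(r), and this slab has mass O(r). If the asymptotic error vanishes, the hyperplane orthogonal to P
  does not cut the balls, the slab meets each of them in a cap of height O(r), and such caps have mass
  O(r^((d+1)/2)). The volume estimates for caps and slabs use only translation
  invariance (packing and covering by translates along the normal direction).\<close>

section \<open>Volumes of slabs and caps\<close>

lemma measure_lborel_translation:
  fixes a :: "'a::euclidean_space"
  assumes "A \<in> sets borel"
  shows "measure lborel ((+) a ` A) = measure lborel A" and "(+) a ` A \<in> sets borel"
proof -
  have vim: "(+) a ` A = (+) (- a) -` A"
    by (force simp: image_iff)
  have "(+) (- a) -` A \<inter> space (borel :: 'a measure) \<in> sets borel"
    by (rule measurable_sets[OF _ assms]) measurable
  then show "(+) a ` A \<in> sets borel" by (simp add: vim)
  then have "measure lborel A = measure (lborel :: 'a measure) ((+) a ` A)"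
    using assms measure_translation[of a A] by simp
  then show "measure lborel ((+) a ` A) = measure lborel A" by simp
qed

lemma fmeasurable_cball: "cball a r \<in> fmeasurable (lborel :: 'a::euclidean_space measure)"
  by (simp add: fmeasurable_def emeasure_lborel_cball_finite[unfolded infinity_ennreal_def])

text \<open>Packing: about R/a disjoint translates of A along u fit into the ball of radius 2R.\<close>
lemma measure_centered_slab_le:
  fixes u :: "'a::euclidean_space"
  assumes A: "A \<in> sets borel" "A \<subseteq> cball 0 R" and u: "norm u = 1"
    and slab: "\<And>x. x \<in> A \<Longrightarrow> c \<le> inner x u \<and> inner x u < c + a" and a: "0 < a" "a \<le> R"
  shows "measure lborel A \<le> 2 * measure lborel (cball (0::'a) 1) * 2 ^ DIM('a) * R ^ DIM('a) * (a / R)"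
proof -
  \<comment> \<open>Shifts along \<open>u\<close> by at most \<open>R\<close> keep \<open>A\<close>
    inside the ball of radius \<open>2 * R\<close>. Since \<open>R / a\<close> is at least 1,
    rounding it down loses at most a factor 2, the leading 2 of the bound.\<close>
  define n where "n = nat \<lfloor>R / a\<rfloor>"
  have ra: "1 \<le> R / a" using a by simp
  have n: "real n \<le> R / a" "R / a < real n + 1" "1 \<le> n"
    using ra by (auto simp: n_def le_nat_floor le_nat_iff) 
  have n2: "R / a \<le> 2 * real n" using n by linarith
  define T where "T i = (+) ((real i * a) *\<^sub>R u) ` A" for i
  have T: "T i \<in> sets borel" "measure lborel (T i) = measure lborel A" for i
    using measure_lborel_translation[OF A(1)] by (auto simp: T_def)
  have sub: "T i \<subseteq> cball 0 (2 * R)" if "i < n" for i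
  proof
    fix y assume "y \<in> T i"
    then obtain x where x: "x \<in> A" "y = (real i * a) *\<^sub>R u + x" by (auto simp: T_def)
    have "real i * a \<le> R / a * a" using n(1) a that by (intro mult_right_mono) auto
    then have "real i * a \<le> R" using a by simp
    moreover have "norm y \<le> real i * a + norm x"
      using norm_triangle_ineq[of "(real i * a) *\<^sub>R u" x] u a x by simp
    moreover have "norm x \<le> R" using x A by auto
    ultimately show "y \<in> cball 0 (2 * R)" by simp
  qed
  have disj: "disjoint_family_on T {..<n}"
  unfolding disjoint_family_on_def
  proof (intro ballI impI)
    fix i j :: nat assume "i \<noteq> j"
    \<comment> \<open>Along \<open>u\<close>, the translate \<open>T i\<close> lies in the half-open
      layer from \<open>c + i * a\<close> to \<open>c + (i + 1) * a\<close>; the strict upper bound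
      keeps neighbouring layers disjoint.\<close>
    have neq: False if "i < j" "x \<in> A" "y \<in> A" "(real i * a) *\<^sub>R u + x = (real j * a) *\<^sub>R u + y" for i j x y
    proof -
      have "inner ((real i * a) *\<^sub>R u + x) u = inner ((real j * a) *\<^sub>R u + y) u" using that by simp
      moreover have "inner u u = 1" using u by (simp add: dot_square_norm)
      ultimately have "real i * a + inner x u = real j * a + inner y u" by (simp add: inner_left_distrib)
      moreover have "(real i + 1) * a \<le> real j * a"
        using that(1) a by (intro mult_right_mono) auto
      ultimately show False using slab[OF that(2)] slab[OF that(3)] by (simp add: algebra_simps)
    qed
    from \<open>i \<noteq> j\<close> consider "i < j" | "j < i" by linarith
    then show "T i \<inter> T j = {}"
    proof cases
      case 1
      then show ?thesis unfolding T_def using neq by blast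
    next
      case 2
      then show ?thesis unfolding T_def using neq[of j i, OF 2 _ _ sym] by blast
    qed
  qed
  have fin: "emeasure lborel (T i) \<noteq> \<infinity>" if "i < n" for i
    using emeasure_mono[OF sub[OF that], of lborel] emeasure_lborel_cball_finite[of "0::'a" "2*R"] by (auto simp: top_unique)
  have "real n * measure lborel A = (\<Sum>i<n. measure lborel (T i))" by (simp add: T)
  also have "\<dots> = measure lborel (\<Union>i<n. T i)"
    by (rule measure_finite_Union[symmetric]) (use T disj fin in auto)
  also have "\<dots> \<le> measure lborel (cball (0::'a) (2 * R))"
    by (rule measure_mono_fmeasurable) (use sub T in \<open>auto intro: fmeasurable_cball\<close>)
  also have "\<dots> = measure lborel (cball (0::'a) 1) * 2 ^ DIM('a) * R ^ DIM('a)"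
    using a by (simp add: content_cball power_mult_distrib)
  finally have *: "real n * measure lborel A \<le> measure lborel (cball (0::'a) 1) * 2 ^ DIM('a) * R ^ DIM('a)" .
  have "R / a * measure lborel A \<le> 2 * (real n * measure lborel A)"
    using mult_right_mono[OF n2, of "measure lborel A"] by simp
  with * have "R / a * measure lborel A \<le> 2 * (measure lborel (cball (0::'a) 1) * 2 ^ DIM('a) * R ^ DIM('a))"
    by linarith
  then show ?thesis using a by (simp add: field_simps)
qed

text \<open>Recentring the ball moves the window for \<open>inner x u\<close> without changing its
  width. \<open>R\<close> stays free because slabs through a unit ball need \<open>R = 1\<close>,
  while small caps are enclosed in balls of a small radius \<open>R\<close>, with \<open>a\<close>
  equal to the square of \<open>R\<close>.\<close>

lemma measure_slab_le:
  fixes u :: "'a::euclidean_space"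
  assumes A: "A \<in> sets borel" "A \<subseteq> cball z R" and u: "norm u = 1"
    and slab: "\<And>x. x \<in> A \<Longrightarrow> c \<le> inner x u \<and> inner x u < c + a" and a: "0 < a" "a \<le> R"
  shows "measure lborel A \<le> 2 * measure lborel (cball (0::'a) 1) * 2 ^ DIM('a) * R ^ DIM('a) * (a / R)"
proof -
  have "measure lborel ((+) (- z) ` A)
    \<le> 2 * measure lborel (cball (0::'a) 1) * 2 ^ DIM('a) * R ^ DIM('a) * (a / R)"
  proof (rule measure_centered_slab_le[OF _ _ u _ a])
    show "(+) (- z) ` A \<subseteq> cball 0 R" using A(2) by (auto simp: dist_norm norm_minus_commute)
    show "c - inner z u \<le> inner x u \<and> inner x u < c - inner z u + a" if "x \<in> (+) (- z) ` A" for x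
      using that slab by (auto simp: inner_diff_left)
  qed (rule measure_lborel_translation[OF A(1)])
  then show ?thesis unfolding measure_lborel_translation[OF A(1)] .
qed

text \<open>Covering: shifted to the origin, 7/r translates of the cap along w cover the ball of radius r/2.\<close>
lemma measure_cap_ge:
  fixes w :: "'a::euclidean_space"
  assumes w: "norm w = 1" and r: "0 < r" "r \<le> 1/2"
  shows "measure lborel {x. norm x \<le> 1 \<and> inner x w > 1 - r\<^sup>2}
    \<ge> measure lborel (cball (0::'a) 1) / (7 * 2 ^ DIM('a)) * r ^ (DIM('a) + 1)"
proof -
  define C where "C = {x. norm x \<le> 1 \<and> inner x w > 1 - r\<^sup>2}"
  define h where "h = r\<^sup>2"
  have h: "0 < h" "h \<le> 1/4"
    using r power_mono[of r "1/2" 2] by (auto simp: h_def power2_eq_square)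
  have ww: "inner w w = 1" using w by (simp add: dot_square_norm)
  have C: "C \<in> sets borel" unfolding C_def by measurable
  \<comment> \<open>A point of the small ball has a \<open>w\<close>-component of size at most
    \<open>r/2\<close>, which is at most \<open>1/r\<close> steps of length \<open>h/2\<close>; the
    ceiling and the offset 1 in the index chosen below cost at most 2 more.\<close>
  define n where "n = nat \<lceil>1/r + 2\<rceil>"
  define I where "I = {- int n..int n}"
  have nr: "1/r + 2 \<le> real n" "real n < 1/r + 3" 
  proof -
    have "real n = real_of_int \<lceil>1/r + 2\<rceil>" unfolding n_def
    proof (intro of_nat_nat)
      have "0 < 1/r" using r by simp
      then show "0 \<le> \<lceil>1/r + 2\<rceil>" by linarith
    qed
    then show "1/r + 2 \<le> real n" "real n < 1/r + 3" by linarith+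
  qed
  have cI: "real (card I) \<le> 7 / r"
  proof -
    have "real (card I) = 2 * real n + 1" by (simp add: I_def)
    also have "\<dots> \<le> 2 / r + 7" using nr by simp
    also have "\<dots> \<le> 7 / r" using r by (simp add: field_simps)
    finally show ?thesis .
  qed
  define T where "T i = (+) ((real_of_int i * (h/2)) *\<^sub>R w - w) ` C" for i
  have T: "T i \<in> sets borel" "measure lborel (T i) = measure lborel C" for i
    using measure_lborel_translation[OF C] by (auto simp: T_def)
  have cover: "cball 0 (r/2) \<subseteq> (\<Union>i\<in>I. T i)"
  proof
    fix y :: 'a assume "y \<in> cball 0 (r/2)"
    then have y: "norm y \<le> r/2" by simp
    define s where "s = inner y w"
    have s: "\<bar>s\<bar> \<le> r/2" using Cauchy_Schwarz_ineq2[of y w] w y by (simp add: s_def)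
    \<comment> \<open>This index puts the \<open>w\<close>-component of \<open>g\<close> between
      \<open>-h\<close> and \<open>-h/2\<close>. The lower end keeps \<open>g + w\<close> above the
      base of the cap; the upper end leaves room for the norm condition, which reads
      \<open>norm g ^ 2 \<le> - 2 * inner g w\<close>.\<close>
    define i where "i = \<lceil>2 * s / h\<rceil> + 1"
    define g where "g = y - (real_of_int i * (h/2)) *\<^sub>R w"
    have i: "2 * s / h + 1 \<le> real_of_int i" "real_of_int i < 2 * s / h + 2"
      unfolding i_def by linarith+
    have gw: "inner g w = s - real_of_int i * (h/2)"
      by (simp add: g_def inner_diff_left ww s_def)
    have g1: "- h < inner g w" "inner g w \<le> - h/2"
      using i h unfolding gw by (auto simp: field_simps)
    \<comment> \<open>Pythagoras: \<open>y\<close> and \<open>g\<close> have the same component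
      orthogonal to \<open>w\<close>.\<close>
    have "norm g ^ 2 = norm y ^ 2 - s^2 + (inner g w)^2"
      unfolding gw unfolding g_def power2_norm_eq_inner s_def
      by (simp add: inner_diff_left inner_diff_right ww inner_commute power2_eq_square algebra_simps)
    also have "\<dots> \<le> h/4 + h * (1/4)"
    proof -
      have "norm y ^ 2 \<le> (r/2)^2" using y by (intro power_mono) auto
      then have "norm y ^ 2 \<le> h/4" by (simp add: h_def power_divide)
      moreover have "(inner g w)^2 \<le> h^2"
        using g1 h by (intro abs_le_square_iff[THEN iffD1]) auto
      moreover have "h^2 \<le> h * (1/4)" unfolding power2_eq_square using h by (intro mult_left_mono) auto
      moreover have "0 \<le> s^2" by simp
      ultimately show ?thesis by linarith
    qed
    also have "\<dots> \<le> - 2 * inner g w" using g1 h by simp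
    finally have "norm (g + w) ^ 2 \<le> 1"
      by (simp add: power2_norm_eq_inner inner_add_left inner_add_right ww inner_commute)
    then have "norm (g + w) \<le> 1" by (simp add: power_le_one_iff abs_square_le_1)
    moreover have "inner (g + w) w > 1 - r\<^sup>2"
      using g1 by (simp add: inner_add_left ww h_def)
    ultimately have "g + w \<in> C" by (simp add: C_def)
    then have "y \<in> T i" unfolding T_def g_def by (rule rev_image_eqI) simp
    moreover have "i \<in> I"
    proof -
      have "\<bar>2 * s / h\<bar> \<le> 1 / r"
        using s r by (simp add: h_def field_simps power2_eq_square)
      then have "\<bar>real_of_int i\<bar> \<le> real n" using i nr by linarith
      then show ?thesis unfolding I_def by auto
    qed
    ultimately show "y \<in> (\<Union>i\<in>I. T i)" by blast
  qed
  have fin: "(\<Union>i\<in>I. T i) \<in> fmeasurable lborel"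
  proof (intro fmeasurable.finite_UN)
    fix i assume "i \<in> I"
    have "T i \<subseteq> cball (((real_of_int i * (h/2)) *\<^sub>R w - w)) 1"
      by (auto simp: T_def C_def dist_norm)
    then show "T i \<in> fmeasurable lborel"
      by (rule fmeasurableI2[OF fmeasurable_cball]) (use T in auto)
  qed (auto simp: I_def)
  have "measure lborel (cball (0::'a) (r/2)) \<le> measure lborel (\<Union>i\<in>I. T i)"
    by (rule measure_mono_fmeasurable[OF cover _ fin]) auto
  also have "\<dots> \<le> (\<Sum>i\<in>I. measure lborel (T i))"
    by (rule measure_UNION_le) (use T in \<open>auto simp: I_def\<close>)
  also have "\<dots> = real (card I) * measure lborel C" by (simp add: T)
  also have "\<dots> \<le> 7 / r * measure lborel C" by (rule mult_right_mono[OF cI]) simp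
  finally have "measure lborel (cball (0::'a) 1) * (r / 2) ^ DIM('a) \<le> 7 / r * measure lborel C"
    using r by (simp add: content_cball)
  then have "measure lborel (cball (0::'a) 1) * (r / 2) ^ DIM('a) * r \<le> 7 * measure lborel C"
    using r by (simp add: field_simps)
  then show ?thesis unfolding C_def[symmetric] by (simp add: power_divide field_simps)
qed

section \<open>The data distribution\<close>

lemma sets_data_dist [measurable_cong]:
  "sets (data_dist \<mu>) = sets (borel \<Otimes>\<^sub>M count_space UNIV)"
  unfolding data_dist_def by (simp, intro sets_pair_measure_cong) auto

lemma space_data_dist [simp]: "space (data_dist \<mu>) = UNIV"
  by (simp add: data_dist_def space_pair_measure)

lemma data_density_measurable [measurable]:
  "(\<lambda>p. ennreal (indicator (cball (center (\<mu> :: 'a) (snd p)) 1) (fst p)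
      / (2 * measure lborel (cball (0::'a::euclidean_space) 1))))
   \<in> borel_measurable (lborel \<Otimes>\<^sub>M count_space UNIV)"
proof -
  have "{p \<in> space (lborel \<Otimes>\<^sub>M count_space UNIV). dist (center \<mu> (snd p)) (fst p) \<le> 1}
    \<in> sets ((lborel :: 'a measure) \<Otimes>\<^sub>M count_space (UNIV :: bool set))"
    unfolding center_def by measurable
  then show ?thesis
    by (intro measurable_compose[OF _ measurable_ennreal] borel_measurable_divide borel_measurable_const)
       (simp add: indicator_def mem_cball measurable_If_restrict_space_iff)
qed

lemma measure_cball_pos: "0 < measure lborel (cball (0::'a::euclidean_space) 1)"
  by (simp add: content_cball)

text \<open>On the slice with label \<open>y\<close> the density is constant on the ball and zero
  elsewhere, so probabilities become ratios of volumes. The factor 2 is the prior of the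
  label.\<close>

lemma emeasure_data_dist:
  fixes \<mu> :: "'a::euclidean_space"
  assumes A: "A \<in> sets borel"
  shows "emeasure (data_dist \<mu>) (A \<times> {y})
    = ennreal (measure lborel (A \<inter> cball (center \<mu> y) 1) / (2 * measure lborel (cball (0::'a) 1)))"
proof -
  interpret c: sigma_finite_measure "count_space (UNIV :: bool set)"
    by (rule sigma_finite_measure_count_space_finite) simp
  define V where "V = measure lborel (cball (0::'a) 1)"
  have V: "0 < V" by (simp add: V_def content_cball)
  have "emeasure (data_dist \<mu>) (A \<times> {y}) = (\<integral>\<^sup>+ p. ennreal (indicator (cball (center \<mu> (snd p)) 1) (fst p)
      / (2 * V)) * indicator (A \<times> {y}) p \<partial>(lborel \<Otimes>\<^sub>M count_space UNIV))"
    unfolding data_dist_def V_def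
    by (rule emeasure_density[OF data_density_measurable]) (use A in auto)
  also have "\<dots> = (\<integral>\<^sup>+ p. ennreal (1 / (2 * V)) * indicator ((A \<inter> cball (center \<mu> y) 1) \<times> {y}) p
      \<partial>(lborel \<Otimes>\<^sub>M count_space UNIV))"
    by (intro nn_integral_cong) (auto simp: indicator_def)
  also have "\<dots> = ennreal (1 / (2 * V)) * emeasure lborel (A \<inter> cball (center \<mu> y) 1)"
    using A by (subst nn_integral_cmult_indicator) (auto simp: c.emeasure_pair_measure_Times)
  also have "emeasure lborel (A \<inter> cball (center \<mu> y) 1) = ennreal (measure lborel (A \<inter> cball (center \<mu> y) 1))"
    by (rule emeasure_eq_measure2, rule fmeasurableI2[OF fmeasurable_cball]) (use A in auto)
  finally show ?thesis using V by (simp add: V_def flip: ennreal_mult)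
qed

lemma measure_data_dist:
  fixes \<mu> :: "'a::euclidean_space"
  assumes "A \<in> sets borel"
  shows "measure (data_dist \<mu>) (A \<times> {y})
    = measure lborel (A \<inter> cball (center \<mu> y) 1) / (2 * measure lborel (cball (0::'a) 1))"
  using emeasure_data_dist[OF assms, of \<mu> y] by (simp add: measure_def)

lemma prob_space_data_dist: "prob_space (data_dist (\<mu> :: 'a::euclidean_space))"
proof
  have "UNIV = (UNIV \<times> {True}) \<union> ((UNIV :: 'a set) \<times> {False})" by auto
  then have "emeasure (data_dist \<mu>) (space (data_dist \<mu>))
    = emeasure (data_dist \<mu>) (UNIV \<times> {True}) + emeasure (data_dist \<mu>) (UNIV \<times> {False})"
    by (simp, subst plus_emeasure) (auto simp: sets_data_dist)
  also have "\<dots> = 1"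
  proof -
    have "measure lborel (cball (center \<mu> y) 1) = measure lborel (cball (0::'a) 1)" for y
      by (simp add: content_cball)
    then have "emeasure (data_dist \<mu>) (UNIV \<times> {y}) = ennreal (1/2)" for y
      using measure_cball_pos[where 'a='a]
      by (simp add: emeasure_data_dist del: ennreal_half)
    then show ?thesis by (simp add: ennreal_plus[symmetric] del: ennreal_half ennreal_plus)
  qed
  finally show "emeasure (data_dist \<mu>) (space (data_dist \<mu>)) = 1" .
qed

interpretation data: prob_space "data_dist \<mu>" for \<mu> :: "'a::euclidean_space"
  by (rule prob_space_data_dist)

interpretation sample: prob_space "PiM {..<N} (\<lambda>_. data_dist \<mu>)"
  for \<mu> :: "'a::euclidean_space" and N :: nat
  by (intro prob_space_PiM prob_space_data_dist)

section \<open>Support of the data and concentration of sample counts\<close>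

lemma AE_data_dist: "AE p in data_dist \<mu>. fst p \<in> cball (center \<mu> (snd p)) 1"
  unfolding data_dist_def by (subst AE_density) (auto simp: indicator_def intro!: AE_I2)

text \<open>The exponential moment is taken at parameter 1; the factor 1/2 comes from 1 - 1/e being at least 1/2.\<close>
lemma prob_few_samples_le:
  assumes "prob_space D" and A: "A \<in> sets D"
  shows "measure (PiM {..<N} (\<lambda>_. D)) {S \<in> space (PiM {..<N} (\<lambda>_. D)). card {i. i < N \<and> S i \<in> A} < k}
    \<le> exp (real k - real N * measure D A / 2)"
proof -
  interpret D: prob_space D by fact
  interpret P: product_prob_space "\<lambda>_::nat. D" by unfold_locales
  interpret F: finite_product_prob_space "\<lambda>_::nat. D" "{..<N}" by standard auto
  let ?P = "PiM {..<N} (\<lambda>_. D)"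
  define p where "p = measure D A"
  have p: "0 \<le> p" "p \<le> 1" by (auto simp: p_def)
  define X where "X S = (\<Sum>i<N. indicator A (S i) :: real)" for S
  have X: "X S = real (card {i. i < N \<and> S i \<in> A})" for S
    by (simp add: X_def indicator_def sum.If_cases Int_def)
  have [measurable]: "X \<in> borel_measurable ?P" unfolding X_def using A by measurable
  \<comment> \<open>The exponential turns the count into a product over samples, and independence
    lets the integral be taken factor by factor.\<close>
  have "ennreal (exp (- X S)) = (\<Prod>i<N. ennreal (exp (- indicator A (S i))))" for S
    by (simp add: X_def prod_ennreal exp_sum flip: sum_negf)
  then have "(\<integral>\<^sup>+ S. ennreal (exp (- X S)) \<partial>?P)
      = (\<integral>\<^sup>+ S. (\<Prod>i<N. (\<lambda>x. ennreal (exp (- indicator A x))) (S i)) \<partial>?P)" by simp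
  also have "\<dots> = (\<Prod>i<N. \<integral>\<^sup>+ x. ennreal (exp (- indicator A x)) \<partial>D)"
    using A by (intro P.product_nn_integral_prod) auto
  also have "\<dots> \<le> (\<Prod>i<N. ennreal (1 - p / 2))"
  proof (intro prod_mono_ennreal)
    have "exp (-1) \<le> (1/2::real)"
    proof -
      have "2 \<le> exp (1::real)" using exp_ge_add_one_self[of 1] by simp
      then show ?thesis by (simp add: exp_minus field_simps)
    qed
    then have "ennreal (exp (-1)) \<le> ennreal (1/2)" by (rule ennreal_leI)
    \<comment> \<open>Pointwise, \<open>exp (- indicator A x)\<close> is at most 1/2 on
      \<open>A\<close> and 1 off \<open>A\<close>, with mean \<open>p / 2 + (1 - p)\<close>.\<close>
    then have "(\<integral>\<^sup>+ x. ennreal (exp (- indicator A x)) \<partial>D)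
      \<le> (\<integral>\<^sup>+ x. ennreal (1/2) * indicator A x + ennreal 1 * indicator (space D - A) x \<partial>D)"
      by (intro nn_integral_mono) (auto simp: indicator_def simp del: ennreal_half)
    also have "\<dots> = ennreal (1/2) * emeasure D A + ennreal 1 * emeasure D (space D - A)"
      using A by (subst nn_integral_add) (auto simp: nn_integral_cmult_indicator)
    also have "\<dots> = ennreal (1 - p / 2)"
    proof -
      have "ennreal (1/2) * emeasure D A + ennreal 1 * emeasure D (space D - A)
        = ennreal (1/2 * p) + ennreal (1 - p)"
        using A p by (simp add: D.emeasure_eq_measure D.prob_compl p_def flip: ennreal_mult' del: ennreal_half)
      also have "\<dots> = ennreal (1 - p / 2)"
        using p by (subst ennreal_plus[symmetric]) auto
      finally show ?thesis .
    qed
    finally show "(\<integral>\<^sup>+ x. ennreal (exp (- indicator A x)) \<partial>D) \<le> ennreal (1 - p / 2)" .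
  qed
  also have "\<dots> = ennreal ((1 - p / 2) ^ N)" using p by (simp add: ennreal_power)
  also have "\<dots> \<le> ennreal (exp (- p / 2) ^ N)"
    using p exp_ge_add_one_self[of "- p / 2"] by (intro ennreal_leI power_mono) auto
  also have "\<dots> = ennreal (exp (- real N * p / 2))"
    by (simp flip: exp_of_nat_mult)
  finally have *: "(\<integral>\<^sup>+ S. ennreal (exp (- X S)) \<partial>?P) \<le> ennreal (exp (- real N * p / 2))" .
  have "emeasure ?P {S \<in> space ?P. X S \<le> real k}
    \<le> ennreal (exp (1 * real k)) * (\<integral>\<^sup>+ S. ennreal (exp (- 1 * X S)) * indicator (space ?P) S \<partial>?P)"
    by (rule Chernoff_ineq_nn_integral_le) auto
  also have "(\<integral>\<^sup>+ S. ennreal (exp (- 1 * X S)) * indicator (space ?P) S \<partial>?P) = (\<integral>\<^sup>+ S. ennreal (exp (- X S)) \<partial>?P)"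
    by (intro nn_integral_cong) auto
  also have "ennreal (exp (1 * real k)) * \<dots> \<le> ennreal (exp (1 * real k)) * ennreal (exp (- real N * p / 2))"
    by (rule mult_left_mono[OF *]) simp
  also have "\<dots> = ennreal (exp (real k - real N * p / 2))"
    by (simp flip: ennreal_mult exp_add)
  finally have "measure ?P {S \<in> space ?P. X S \<le> real k} \<le> exp (real k - real N * p / 2)"
    by (simp add: F.emeasure_eq_measure)
  moreover have "measure ?P {S \<in> space ?P. card {i. i < N \<and> S i \<in> A} < k} \<le> measure ?P {S \<in> space ?P. X S \<le> real k}"
  proof (rule F.finite_measure_mono)
    show "{S \<in> space ?P. X S \<le> real k} \<in> sets ?P" by measurable
  qed (use X in \<open>auto simp del: space_PiM\<close>)
  ultimately show ?thesis by (simp add: p_def)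
qed

section \<open>Memory and nearest-element rule\<close>

text \<open>The function is the entropy of a binary prediction with logit \<open>x\<close>. In this
  factored form the derivative visibly has the sign of \<open>- x\<close>.\<close>

lemma DERIV_logistic_entropy:
  "((\<lambda>x::real. ln (1 + exp (- x)) + x / (1 + exp x)) has_real_derivative - x * exp x / (1 + exp x)\<^sup>2) (at x)"
proof -
  have p: "0 < 1 + exp x" "0 < 1 + exp (- x)" by (auto intro: add_pos_pos)
  have e: "exp (- x) = 1 / exp x" by (simp add: exp_minus field_simps)
  have "((\<lambda>x::real. ln (1 + exp (- x)) + x / (1 + exp x)) has_real_derivative
     (- exp (- x)) / (1 + exp (- x)) + (1 * (1 + exp x) - x * exp x) / ((1 + exp x) * (1 + exp x))) (at x)"
    using p by (auto intro!: derivative_eq_intros)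
  moreover have "(- exp (- x)) / (1 + exp (- x)) = - 1 / (1 + exp x)"
    using p unfolding e by (simp add: field_simps)
  moreover have "- 1 / (1 + exp x) + (1 * (1 + exp x) - x * exp x) / ((1 + exp x) * (1 + exp x))
      = - x * exp x / (1 + exp x)\<^sup>2"
    using p by (simp add: diff_divide_distrib power2_eq_square)
  ultimately show ?thesis by simp
qed

text \<open>Swapping the two classes negates the logit and preserves the entropy, so the formula can
  be written in the absolute value. This puts both predicted classes on one scale of
  confidence.\<close>

lemma entropy_eq:
  "entropy t w b f = ln (1 + exp (- \<bar>t * zpre w b f\<bar>)) + \<bar>t * zpre w b f\<bar> / (1 + exp \<bar>t * zpre w b f\<bar>)"
proof -
  define E where "E x = ln (1 + exp (- x)) + x / (1 + exp x)" for x :: real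
  define x where "x = t * zpre w b f"
  have p: "0 < 1 + exp y" for y :: real by (auto intro: add_pos_pos)
  have q: "1 - 1 / (1 + exp (- x)) = 1 / (1 + exp x)"
    using p[of x] p[of "-x"] by (simp add: exp_minus field_simps)
  have l: "ln (1 / (1 + exp y)) = - ln (1 + exp y)" for y :: real
    using p[of y] by (simp add: ln_div)
  have l2: "ln (1 + exp y) = y + ln (1 + exp (- y))" for y :: real
  proof -
    have "1 + exp y = exp y * (1 + exp (- y))"
      by (simp add: algebra_simps flip: exp_add)
    then have "ln (1 + exp y) = ln (exp y * (1 + exp (- y)))" by (rule arg_cong)
    also have "\<dots> = y + ln (1 + exp (- y))" using p[of "-y"] by (subst ln_mult_pos) auto
    finally show ?thesis .
  qed
  have q2: "1 / (1 + exp (- x)) = 1 - 1 / (1 + exp x)" using q by simp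
  have "entropy t w b f = 1 / (1 + exp (- x)) * ln (1 + exp (- x)) + 1 / (1 + exp x) * ln (1 + exp x)"
    unfolding entropy_def Let_def phat1_def mult_minus_left x_def[symmetric] q by (simp add: l)
  also have "\<dots> = E x" unfolding q2 l2[of x] E_def by (simp add: algebra_simps add_divide_distrib)
  also have "\<dots> = E \<bar>x\<bar>"
  proof -
    have "E (- x) = ln (1 + exp x) - x * (1 / (1 + exp (- x)))" by (simp add: E_def)
    also have "\<dots> = E x" unfolding q2 l2[of x] E_def by (simp add: right_diff_distrib)
    finally have "E (- x) = E x" .
    then show ?thesis by (auto simp: abs_if)
  qed
  finally show ?thesis by (simp add: E_def x_def)
qed

lemma entropy_strict_antimono:
  assumes "0 < t" "\<bar>zpre w b g\<bar> < \<bar>zpre w b f\<bar>"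
  shows "entropy t w b f < entropy t w b g"
proof -
  have "\<bar>t * zpre w b g\<bar> < \<bar>t * zpre w b f\<bar>" using assms by (simp add: abs_mult)
  then show ?thesis unfolding entropy_eq
  \<comment> \<open>The left endpoint may be 0, where the derivative vanishes; hence negativity is
    used only in the open interval, with continuity on the closed one.\<close>
  proof (rule DERIV_neg_imp_decreasing_open)
    fix x assume x: "\<bar>t * zpre w b g\<bar> < x" "x < \<bar>t * zpre w b f\<bar>"
    have "0 < 1 + exp x" by (auto intro: add_pos_pos)
    with x have "- x * exp x / (1 + exp x)\<^sup>2 < 0" by (auto intro!: divide_neg_pos mult_neg_pos)
    then show "\<exists>y. ((\<lambda>x. ln (1 + exp (- x)) + x / (1 + exp x)) has_real_derivative y) (at x) \<and> y < 0"
      using DERIV_logistic_entropy by blast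
  next
    show "continuous_on {\<bar>t * zpre w b g\<bar>..\<bar>t * zpre w b f\<bar>} (\<lambda>x. ln (1 + exp (- x)) + x / (1 + exp x))"
      by (intro continuous_at_imp_continuous_on ballI DERIV_isCont[OF DERIV_logistic_entropy])
  qed
qed

text \<open>The minimum in the lexicographic order by entropy and index has no predecessor, so it is
  selected as soon as \<open>k\<close> is positive.\<close>

lemma memory_nonempty:
  assumes "1 \<le> k" "j < N" "yhat w b (F j) = y"
  shows "memory t w b k N F y \<noteq> {}"
proof -
  define A where "A = {j. j < N \<and> yhat w b (F j) = y}"
  have A: "finite A" "A \<noteq> {}" using assms by (auto simp: A_def)
  define e where "e = Min ((\<lambda>j. entropy t w b (F j)) ` A)"
  have "e \<in> (\<lambda>j. entropy t w b (F j)) ` A" unfolding e_def using A by (intro Min_in) auto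
  then obtain j0 where "j0 \<in> A \<and> entropy t w b (F j0) = e" by auto
  \<comment> \<open>The least index among the minimisers of the entropy, in accordance with the
    tie-breaking of \<open>memory\<close>.\<close>
  define j where "j = (LEAST j. j \<in> A \<and> entropy t w b (F j) = e)"
  have j: "j \<in> A" "entropy t w b (F j) = e"
    using LeastI[of "\<lambda>j. j \<in> A \<and> entropy t w b (F j) = e", OF \<open>j0 \<in> A \<and> _\<close>] by (auto simp: j_def)
  have ge: "e \<le> entropy t w b (F i)" if "i \<in> A" for i
    unfolding e_def using A that by (intro Min_le) auto
  have none: "{i. i < N \<and> yhat w b (F i) = y \<and> (entropy t w b (F i) < entropy t w b (F j) \<or>
         (entropy t w b (F i) = entropy t w b (F j) \<and> i < j))} = {}"
    using ge not_less_Least[of _ "\<lambda>j. j \<in> A \<and> entropy t w b (F j) = e"]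
    unfolding j(2) j_def[symmetric] by (fastforce simp: A_def)
  have "j \<in> memory t w b k N F y"
    unfolding memory_def mem_Collect_eq none using j(1) assms(1) by (simp add: A_def)
  then show ?thesis by auto
qed

text \<open>A sample with confidence at most \<open>c\<close> is preceded in entropy by all the
  samples counted in the second hypothesis. These are at least \<open>k\<close>, so it cannot be
  selected.\<close>

lemma memory_confident:
  assumes "0 < t" and k: "k \<le> card {i. i < N \<and> yhat w b (F i) = y \<and> c < \<bar>zpre w b (F i)\<bar>}"
    and j: "j \<in> memory t w b k N F y"
  shows "j < N \<and> yhat w b (F j) = y \<and> c < \<bar>zpre w b (F j)\<bar>"
proof (rule ccontr)
  assume "\<not> ?thesis"
  with j have le: "\<bar>zpre w b (F j)\<bar> \<le> c" by (auto simp: memory_def)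
  have "card {i. i < N \<and> yhat w b (F i) = y \<and> c < \<bar>zpre w b (F i)\<bar>}
    \<le> card {i. i < N \<and> yhat w b (F i) = y \<and> (entropy t w b (F i) < entropy t w b (F j) \<or>
         (entropy t w b (F i) = entropy t w b (F j) \<and> i < j))}"
  proof (intro card_mono subsetI)
    fix i assume "i \<in> {i. i < N \<and> yhat w b (F i) = y \<and> c < \<bar>zpre w b (F i)\<bar>}"
    moreover from this le have "entropy t w b (F i) < entropy t w b (F j)"
      by (intro entropy_strict_antimono[OF assms(1)]) auto
    ultimately show "i \<in> {i. i < N \<and> yhat w b (F i) = y \<and> (entropy t w b (F i) < entropy t w b (F j) \<or>
         (entropy t w b (F i) = entropy t w b (F j) \<and> i < j))}" by simp
  qed simp
  with k j show False by (auto simp: memory_def)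
qed

section \<open>Memories concentrated at the tips of the balls\<close>

text \<open>It is used with \<open>P = \<mu> + w\<close>, where \<open>center P y\<close> is the tip
  of the ball of label \<open>y\<close>, its extreme point in the direction
  \<open>center w y\<close>. Nonemptiness is included because the nearest-element rule has to
  compare both classes.\<close>

definition good_memory ::
  "real \<Rightarrow> 'a::euclidean_space \<Rightarrow> real \<Rightarrow> nat \<Rightarrow> nat \<Rightarrow> 'a \<Rightarrow> real \<Rightarrow> (nat \<Rightarrow> 'a) \<Rightarrow> bool" where
  "good_memory t w b k N P \<rho> F = (\<forall>y. memory t w b k N F y \<noteq> {} \<and>
     (\<forall>j \<in> memory t w b k N F y. dist (F j) (center P y) \<le> \<rho>))"

text \<open>The height is the square of \<open>r\<close> because such a cap lies within a distance
  of order \<open>r\<close> of its tip.\<close>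

definition tip_cap :: "'a::euclidean_space \<Rightarrow> 'a \<Rightarrow> real \<Rightarrow> bool \<Rightarrow> 'a set" where
  "tip_cap \<mu> w r y = {x. norm (x - center \<mu> y) \<le> 1 \<and> inner (x - center \<mu> y) (center w y) > 1 - r\<^sup>2}"

text \<open>The bounds on the square of \<open>r\<close> have separate purposes: the first keeps the
  opposite ball below the base of the cap, the other two make all points of the cap receive the
  predicted label of their ball, one for each class.\<close>

lemma good_memoryI:
  fixes \<mu> w :: "'a::euclidean_space"
  assumes w: "norm w = 1" and t: "0 < t" and k: "1 \<le> k" and r: "0 < r"
    and rm: "r\<^sup>2 \<le> 2 * inner \<mu> w" "r\<^sup>2 < inner \<mu> w + 1 + b" "r\<^sup>2 < inner \<mu> w + 1 - b"
    and F: "\<And>i. i < N \<Longrightarrow> \<exists>y. F i \<in> cball (center \<mu> y) 1"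
    and card: "\<And>y. k \<le> card {i. i < N \<and> F i \<in> tip_cap \<mu> w r y}"
  shows "good_memory t w b k N (\<mu> + w) (2 * r) F"
  unfolding good_memory_def
proof (intro allI conjI ballI)
  fix y
  \<comment> \<open>The label as a sign, so that one argument covers both classes.\<close>
  define \<sigma> where "\<sigma> = (if y then 1 else - 1 :: real)"
  \<comment> \<open>The value of \<open>\<sigma> * zpre w b\<close> on the base of the cap, hence
    the confidence that any point of the cap exceeds.\<close>
  define c where "c = inner \<mu> w + 1 - r\<^sup>2 + \<sigma> * b"
  have c: "0 < c" using rm by (auto simp: c_def \<sigma>_def)
  have center: "center v y = \<sigma> *\<^sub>R v" for v :: 'a by (simp add: center_def \<sigma>_def)
  have s2: "\<sigma> * \<sigma> = 1" by (simp add: \<sigma>_def)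
  have cap: "yhat w b x = y \<and> c < \<bar>zpre w b x\<bar>" if "x \<in> tip_cap \<mu> w r y" for x
  proof -
    have "\<sigma> * zpre w b x > c"
      using that s2 by (simp add: tip_cap_def center zpre_def c_def inner_diff_left algebra_simps flip: mult.assoc)
    then show ?thesis using c by (auto simp: yhat_def \<sigma>_def split: if_splits)
  qed
  have "{i. i < N \<and> F i \<in> tip_cap \<mu> w r y} \<subseteq> {i. i < N \<and> yhat w b (F i) = y \<and> c < \<bar>zpre w b (F i)\<bar>}"
    using cap by auto
  then have k2: "k \<le> card {i. i < N \<and> yhat w b (F i) = y \<and> c < \<bar>zpre w b (F i)\<bar>}"
    by (intro order_trans[OF card[of y] card_mono]) auto
  then have "{i. i < N \<and> yhat w b (F i) = y \<and> c < \<bar>zpre w b (F i)\<bar>} \<noteq> {}"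
    using k by (metis card.empty not_one_le_zero le_trans)
  then show "memory t w b k N F y \<noteq> {}" using memory_nonempty[OF k] by blast
  fix j assume "j \<in> memory t w b k N F y"
  from memory_confident[OF t k2 this]
  have j: "j < N" "yhat w b (F j) = y" "c < \<bar>zpre w b (F j)\<bar>" by auto
  then have "c < \<sigma> * zpre w b (F j)" by (auto simp: yhat_def \<sigma>_def)
  then have z: "inner \<mu> w + 1 - r\<^sup>2 < inner (F j) (\<sigma> *\<^sub>R w)"
    by (simp add: zpre_def c_def algebra_simps)
  obtain y' where y': "F j \<in> cball (center \<mu> y') 1" using F j by auto
  then have n1: "norm (F j - center \<mu> y') \<le> 1" by (simp add: dist_norm norm_minus_commute)
  have sw: "norm (\<sigma> *\<^sub>R w) = 1" using w by (simp add: \<sigma>_def)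
  \<comment> \<open>In the direction \<open>\<sigma> *\<^sub>R w\<close> the opposite ball reaches
    only \<open>1 - inner \<mu> w\<close>, which is at most the level in \<open>z\<close> by the
    first bound on the square of \<open>r\<close>.\<close>
  have "y' = y"
  proof (rule ccontr)
    assume "y' \<noteq> y"
    then have "center \<mu> y' = - (\<sigma> *\<^sub>R \<mu>)" by (auto simp: center_def \<sigma>_def)
    moreover have "inner (F j - center \<mu> y') (\<sigma> *\<^sub>R w) \<le> 1"
      using norm_cauchy_schwarz[of "F j - center \<mu> y'" "\<sigma> *\<^sub>R w"] sw n1 by simp
    ultimately have "inner (F j) (\<sigma> *\<^sub>R w) \<le> 1 - inner \<mu> w"
      using s2 by (simp add: inner_add_left distrib_left flip: mult.assoc)
    with z rm show False by simp
  qed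
  define d where "d = F j - \<sigma> *\<^sub>R \<mu>"
  have d: "norm d \<le> 1" using n1 \<open>y' = y\<close> by (simp add: d_def center)
  have di: "inner d (\<sigma> *\<^sub>R w) > 1 - r\<^sup>2"
    using z s2 by (simp add: d_def inner_diff_left right_diff_distrib flip: mult.assoc)
  have "(dist (F j) (center (\<mu> + w) y))\<^sup>2 = (norm (d - \<sigma> *\<^sub>R w))\<^sup>2"
    by (simp add: dist_norm d_def center scaleR_right_distrib diff_diff_eq)
  also have "\<dots> = (norm d)\<^sup>2 + 1 - 2 * inner d (\<sigma> *\<^sub>R w)"
  proof -
    have "inner (\<sigma> *\<^sub>R w) (\<sigma> *\<^sub>R w) = 1" using sw by (simp only: dot_square_norm one_power2)
    then show ?thesis
      unfolding power2_norm_eq_inner inner_diff_left inner_diff_right inner_commute[of "\<sigma> *\<^sub>R w" d] by simp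
  qed
  \<comment> \<open>The left side is in fact below twice the square of \<open>r\<close>; the
    constant 2 in \<open>2 * r\<close> is chosen for convenience.\<close>
  also have "\<dots> \<le> (2 * r)\<^sup>2"
  proof -
    have "(norm d)\<^sup>2 \<le> 1" using d by (simp add: power_le_one)
    moreover have "0 \<le> r\<^sup>2" by simp
    moreover have "(2 * r)\<^sup>2 = 4 * r\<^sup>2" by simp
    ultimately show ?thesis using di by linarith
  qed
  finally show "dist (F j) (center (\<mu> + w) y) \<le> 2 * r"
    by (rule power2_le_imp_le) (use r in simp)
qed

text \<open>The squared distances of \<open>f\<close> to \<open>- P\<close> and \<open>P\<close>
  differ by \<open>4 * inner f P\<close>, which factors as \<open>(B - A) * (A + B)\<close>. As
  \<open>A + B\<close> is bounded, \<open>far\<close> forces the distances to differ by more than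
  \<open>4 * r\<close>. That gap absorbs the displacement \<open>2 * r\<close> of each of the two
  memory elements compared.\<close>

lemma h_post_eq_h_asym:
  fixes \<mu> w f :: "'a::euclidean_space"
  assumes w: "norm w = 1" and good: "good_memory t w b k N (\<mu> + w) (2 * r) F"
    and r: "0 < r" and f: "norm f \<le> norm \<mu> + 1" and far: "4 * r * (norm \<mu> + 1) < \<bar>inner f (\<mu> + w)\<bar>"
  shows "h_post t w b k N F f = h_asym \<mu> w f"
proof -
  define P where "P = \<mu> + w"
  define A where "A = dist f P"
  define B where "B = dist f (- P)"
  have mem: "dist (F j) P \<le> 2 * r" if "j \<in> memory t w b k N F True" for j
    using good[unfolded good_memory_def, THEN spec[of _ True]] that by (simp add: center_def P_def)
  have mem': "dist (F j) (- P) \<le> 2 * r" if "j \<in> memory t w b k N F False" for j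
    using good[unfolded good_memory_def, THEN spec[of _ False]] that by (simp add: center_def P_def)
  have dA: "A - 2 * r \<le> dist f (F j)" "dist f (F j) \<le> A + 2 * r" if "j \<in> memory t w b k N F True" for j
    using mem[OF that] dist_triangle[of f P "F j"] dist_triangle[of f "F j" P]
    by (auto simp: A_def dist_commute)
  have dB: "B - 2 * r \<le> dist f (F j)" "dist f (F j) \<le> B + 2 * r" if "j \<in> memory t w b k N F False" for j
    using mem'[OF that] dist_triangle[of f "-P" "F j"] dist_triangle[of f "F j" "-P"]
    by (auto simp: B_def dist_commute)
  have "norm P \<le> norm \<mu> + 1" using norm_triangle_ineq[of \<mu> w] w by (simp add: P_def)
  then have AB: "A + B \<le> 4 * (norm \<mu> + 1)" "0 \<le> A" "0 \<le> B"
    using f norm_triangle_ineq4[of f P] norm_triangle_ineq[of f P] by (auto simp: A_def B_def dist_norm)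
  have diff: "(B - A) * (A + B) = 4 * inner f P"
  proof -
    have "(B - A) * (A + B) = B\<^sup>2 - A\<^sup>2" by (simp add: power2_eq_square algebra_simps)
    also have "\<dots> = 4 * inner f P"
      by (simp add: A_def B_def dist_norm power2_norm_eq_inner inner_diff_left inner_diff_right
          inner_add_left inner_add_right inner_commute)
    finally show ?thesis .
  qed
  have le: "4 * r * (A + B) \<le> 4 * (4 * r * (norm \<mu> + 1))"
    using mult_left_mono[OF AB(1), of "4 * r"] r by (simp add: algebra_simps)
  show ?thesis
  proof (cases "inner f P > 0")
    case True
    have "B - A > 4 * r"
    proof (rule ccontr)
      assume "\<not> B - A > 4 * r"
      then have "(B - A) * (A + B) \<le> 4 * r * (A + B)" using AB by (intro mult_right_mono) auto
      with True diff le far show False by (simp add: P_def)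
    qed
    note gap = this
    obtain j where j: "j \<in> memory t w b k N F True"
      using good by (auto simp: good_memory_def)
    have "dist f (F j) < dist f (F i)" if "i \<in> memory t w b k N F False" for i
      using gap dA(2)[OF j] dB(1)[OF that] by linarith
    with j have "h_post t w b k N F f" unfolding h_post_def by blast
    with True show ?thesis by (simp add: h_asym_def P_def)
  next
    case False
    have "A - B > 4 * r"
    proof (rule ccontr)
      assume "\<not> A - B > 4 * r"
      then have "(A - B) * (A + B) \<le> 4 * r * (A + B)" using AB by (intro mult_right_mono) auto
      moreover have "(A - B) * (A + B) = - 4 * inner f P" using diff by (simp add: algebra_simps)
      ultimately show False using False le far by (simp add: P_def)
    qed
    note gap = this
    obtain i where i: "i \<in> memory t w b k N F False"
      using good by (auto simp: good_memory_def)
    have "\<not> dist f (F j) < dist f (F i)" if "j \<in> memory t w b k N F True" for j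
      using gap dA(1)[OF that] dB(2)[OF i] by linarith
    with i have "\<not> h_post t w b k N F f" unfolding h_post_def by blast
    with False show ?thesis by (simp add: h_asym_def P_def)
  qed
qed

section \<open>Error of the adapted classifier\<close>

lemma data_dist_sum_labels:
  fixes \<mu> :: "'a::euclidean_space"
  assumes W: "\<And>y. W y \<in> sets borel"
  shows "measure (data_dist \<mu>) {p. fst p \<in> W (snd p)} = (measure lborel (W True \<inter> cball (center \<mu> True) 1)
    + measure lborel (W False \<inter> cball (center \<mu> False) 1)) / (2 * measure lborel (cball (0::'a) 1))"
    and "{p. fst p \<in> W (snd p)} \<in> sets (data_dist \<mu>)"
proof -
  have eq: "{p. fst p \<in> W (snd p)} = W True \<times> {True} \<union> W False \<times> {False}"
  proof (rule set_eqI)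
    fix p :: "'a \<times> bool"
    show "p \<in> {p. fst p \<in> W (snd p)} \<longleftrightarrow> p \<in> W True \<times> {True} \<union> W False \<times> {False}"
      by (cases p; cases "snd p") auto
  qed
  have s: "W y \<times> {y} \<in> sets (data_dist \<mu>)" for y using W by (auto simp: sets_data_dist)
  then show "{p. fst p \<in> W (snd p)} \<in> sets (data_dist \<mu>)" unfolding eq by auto
  show "measure (data_dist \<mu>) {p. fst p \<in> W (snd p)} = (measure lborel (W True \<inter> cball (center \<mu> True) 1)
    + measure lborel (W False \<inter> cball (center \<mu> False) 1)) / (2 * measure lborel (cball (0::'a) 1))"
    unfolding eq using s W by (subst data.finite_measure_Union) (auto simp: measure_data_dist add_divide_distrib)
qed

text \<open>Both labels have weight 1/2, so a common bound on the share of each ball occupied by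
  \<open>W\<close> bounds the mean. \<open>W\<close> may depend on the label, as the caps below
  do.\<close>

lemma measure_data_dist_le:
  fixes \<mu> :: "'a::euclidean_space"
  assumes W: "\<And>y. W y \<in> sets borel"
    and le: "\<And>y. measure lborel (W y \<inter> cball (center \<mu> y) 1) \<le> measure lborel (cball (0::'a) 1) * B"
  shows "measure (data_dist \<mu>) {p. fst p \<in> W (snd p)} \<le> B"
proof -
  have "measure lborel (W True \<inter> cball (center \<mu> True) 1) + measure lborel (W False \<inter> cball (center \<mu> False) 1)
      \<le> 2 * measure lborel (cball (0::'a) 1) * B"
    using le[of True] le[of False] by simp
  then show ?thesis unfolding data_dist_sum_labels(1)[of W, OF W]
    using measure_cball_pos[where 'a='a] by (simp add: pos_divide_le_eq mult.commute)
qed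

lemma sets_h_asym_error: "{p. h_asym \<mu> w (fst p) \<noteq> snd p} \<in> sets (data_dist \<mu>)"
proof -
  have "{f. h_asym \<mu> w f \<noteq> y} \<in> sets borel" for y unfolding h_asym_def by measurable
  from data_dist_sum_labels(2)[of "\<lambda>y. {f. h_asym \<mu> w f \<noteq> y}", OF this] show ?thesis by simp
qed

lemma norm_le_of_cball_center: "f \<in> cball (center \<mu> y) 1 \<Longrightarrow> norm f \<le> norm \<mu> + 1"
  using norm_triangle_ineq2[of f "center \<mu> y"]
  by (auto simp: center_def dist_norm norm_minus_commute split: if_splits)

text \<open>On the support of the data, the adapted and the asymptotic rule can differ only in a
  slab around the hyperplane orthogonal to \<open>P\<close>. Its mass is linear in
  \<open>r\<close>.\<close>

lemma err_le_err_asym_plus: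
  fixes \<mu> w :: "'a::euclidean_space"
  assumes w: "norm w = 1" and m: "inner \<mu> w > 0"
    and good: "good_memory t w b k N (\<mu> + w) (2 * r) F" and r: "0 < r"
    and small: "12 * (norm \<mu> + 1) / norm (\<mu> + w) * r \<le> 1"
  shows "err (data_dist \<mu>) (h_post t w b k N F)
    \<le> err (data_dist \<mu>) (h_asym \<mu> w) + 2 * 2 ^ DIM('a) * (12 * (norm \<mu> + 1) / norm (\<mu> + w)) * r"
proof -
  define P where "P = \<mu> + w"
  have ww: "inner w w = 1" using w by (simp add: dot_square_norm)
  have "inner P w > 0" using m by (simp add: P_def inner_add_left ww)
  then have P: "norm P > 0" by auto
  define s where "s = 4 * r * (norm \<mu> + 1)"
  have s: "0 < s" using r by (simp add: s_def add_nonneg_pos)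
  define W where "W = {f. \<bar>inner f P\<bar> \<le> s}"
  have W: "W \<in> sets borel" unfolding W_def by measurable
  \<comment> \<open>The slab has width \<open>2 * s / norm P\<close>; the value
    \<open>3 * s / norm P\<close> makes the upper inequality strict. With the 4 in \<open>s\<close>
    this gives the constant 12.\<close>
  have a: "0 < 3 * s / norm P" "3 * s / norm P \<le> 1"
    using s P small by (auto simp: s_def P_def algebra_simps)
  have "measure (data_dist \<mu>) {p. fst p \<in> W} \<le> 2 * 2 ^ DIM('a) * (3 * s / norm P)"
  proof (rule measure_data_dist_le[of "\<lambda>_. W"])
    fix y
    have "measure lborel (W \<inter> cball (center \<mu> y) 1)
      \<le> 2 * measure lborel (cball (0::'a) 1) * 2 ^ DIM('a) * 1 ^ DIM('a) * (3 * s / norm P / 1)"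
    proof (rule measure_slab_le[where u = "P /\<^sub>R norm P" and c = "- s / norm P"])
      fix x assume "x \<in> W \<inter> cball (center \<mu> y) 1"
      then have "- s \<le> inner x P" "inner x P \<le> s" by (auto simp: W_def)
      then show "- s / norm P \<le> inner x (P /\<^sub>R norm P) \<and> inner x (P /\<^sub>R norm P) < - s / norm P + 3 * s / norm P"
        using P s by (simp add: field_simps)
    qed (use W P a in auto)
    then show "measure lborel (W \<inter> cball (center \<mu> y) 1)
      \<le> measure lborel (cball (0::'a) 1) * (2 * 2 ^ DIM('a) * (3 * s / norm P))"
      by (simp add: mult_ac)
  qed (rule W)
  moreover have "err (data_dist \<mu>) (h_post t w b k N F)
    \<le> measure (data_dist \<mu>) ({p. h_asym \<mu> w (fst p) \<noteq> snd p} \<union> {p. fst p \<in> W})"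
    unfolding err_def
  proof (rule data.finite_measure_mono_AE)
    show "AE p in data_dist \<mu>. p \<in> {p \<in> space (data_dist \<mu>). h_post t w b k N F (fst p) \<noteq> snd p} \<longrightarrow>
        p \<in> {p. h_asym \<mu> w (fst p) \<noteq> snd p} \<union> {p. fst p \<in> W}"
      using AE_data_dist
    proof eventually_elim
      case (elim p)
      then show ?case
        using h_post_eq_h_asym[OF w good r norm_le_of_cball_center[OF elim]]
        by (auto simp: W_def s_def P_def not_le)
    qed
    show "{p. h_asym \<mu> w (fst p) \<noteq> snd p} \<union> {p. fst p \<in> W} \<in> sets (data_dist \<mu>)"
      using sets_h_asym_error data_dist_sum_labels(2)[of "\<lambda>_. W", OF W] by auto
  qed
  moreover have "\<dots> \<le> measure (data_dist \<mu>) {p. h_asym \<mu> w (fst p) \<noteq> snd p} + measure (data_dist \<mu>) {p. fst p \<in> W}"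
    using sets_h_asym_error data_dist_sum_labels(2)[of "\<lambda>_. W", OF W] by (intro measure_Un_le) auto
  ultimately show ?thesis
    by (simp add: err_def s_def P_def mult_ac)
qed

section \<open>Vanishing asymptotic error\<close>

text \<open>If \<open>\<mu>\<close> were closer than 1 to the hyperplane, or on its wrong side, the
  ball of label 1 would contain an open set of misclassified points, and the error would be
  positive.\<close>

lemma separated_of_err_asym_zero:
  fixes \<mu> w :: "'a::euclidean_space"
  assumes P: "\<mu> + w \<noteq> 0" and zero: "err (data_dist \<mu>) (h_asym \<mu> w) = 0"
  shows "norm (\<mu> + w) \<le> inner \<mu> (\<mu> + w)"
proof (rule ccontr)
  define P where "P = \<mu> + w"
  assume "\<not> norm (\<mu> + w) \<le> inner \<mu> (\<mu> + w)"
  then have lt: "inner \<mu> P < norm P" by (simp add: P_def)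
  have nP: "0 < norm P" using P by (simp add: P_def)
  \<comment> \<open>The distance to walk from \<open>\<mu>\<close> against \<open>P\<close>: less
    than 1 to stay in the open ball, more than the signed distance to the hyperplane to cross it.
    The maximum with 0 covers a centre already across.\<close>
  obtain \<theta> where \<theta>: "0 \<le> \<theta>" "\<theta> < 1" "inner \<mu> P < \<theta> * norm P"
  proof -
    have "max 0 (inner \<mu> P / norm P) < 1" using lt nP by simp
    then obtain \<theta> where "max 0 (inner \<mu> P / norm P) < \<theta>" "\<theta> < 1" using dense by blast
    then show ?thesis using nP by (intro that[of \<theta>]) (auto simp: field_simps)
  qed
  define U where "U = {f. inner f P < 0} \<inter> ball \<mu> 1"
  have U: "open U" unfolding U_def by (intro open_Int open_ball open_Collect_less continuous_intros)
  have "\<mu> - (\<theta> / norm P) *\<^sub>R P \<in> U"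
    using \<theta> nP by (simp add: U_def inner_diff_left dist_norm dot_square_norm power2_eq_square)
  then obtain e where e: "0 < e" "ball (\<mu> - (\<theta> / norm P) *\<^sub>R P) e \<subseteq> U"
    using U open_contains_ball by blast
  define A where "A = {f. \<not> h_asym \<mu> w f}"
  have A: "A \<in> sets borel" unfolding A_def h_asym_def by measurable
  have "0 < measure lborel (ball (\<mu> - (\<theta> / norm P) *\<^sub>R P) e)" using e by simp
  also have "\<dots> \<le> measure lborel (A \<inter> cball (center \<mu> True) 1)"
  proof (rule measure_mono_fmeasurable)
    show "A \<inter> cball (center \<mu> True) 1 \<in> fmeasurable lborel"
      by (rule fmeasurableI2[OF fmeasurable_cball]) (use A in auto)
    show "ball (\<mu> - (\<theta> / norm P) *\<^sub>R P) e \<subseteq> A \<inter> cball (center \<mu> True) 1"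
      using e(2) by (auto simp: U_def A_def h_asym_def center_def P_def subset_iff)
  qed simp
  finally have "0 < measure (data_dist \<mu>) (A \<times> {True})"
    unfolding measure_data_dist[OF A] using measure_cball_pos[where 'a='a] by simp
  also have "\<dots> \<le> err (data_dist \<mu>) (h_asym \<mu> w)"
    unfolding err_def space_data_dist
    by (rule data.finite_measure_mono) (use sets_h_asym_error in \<open>auto simp: A_def\<close>)
  finally show False using zero by simp
qed

text \<open>Each ball now lies on its own side of the hyperplane, so the uncertain region meets it
  only in a cap of height at most half the square of \<open>R\<close>. The cap fits in a ball of
  radius \<open>R\<close>, and the volume bound for slabs gives a mass of order
  \<open>R ^ (DIM('a) + 1)\<close>.\<close>

lemma err_le_of_err_asym_zero:
  fixes \<mu> w :: "'a::euclidean_space"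
  assumes w: "norm w = 1" and m: "inner \<mu> w > 0"
    and good: "good_memory t w b k N (\<mu> + w) (2 * r) F" and r: "0 < r"
    and zero: "err (data_dist \<mu>) (h_asym \<mu> w) = 0"
    and \<kappa>: "\<kappa> = 8 * (norm \<mu> + 1) / norm (\<mu> + w)" and small: "\<kappa> * r \<le> 1"
  shows "err (data_dist \<mu>) (h_post t w b k N F) \<le> 2 * 2 ^ DIM('a) * sqrt (\<kappa> * r) ^ (DIM('a) + 1)"
proof -
  define P where "P = \<mu> + w"
  have ww: "inner w w = 1" using w by (simp add: dot_square_norm)
  have "inner P w > 0" using m by (simp add: P_def inner_add_left ww)
  then have P: "norm P > 0" "P \<noteq> 0" by auto
  have sep: "norm P \<le> inner \<mu> P" using separated_of_err_asym_zero[OF _ zero] P by (simp add: P_def)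
  define s where "s = 4 * r * (norm \<mu> + 1)"
  have \<kappa>s: "\<kappa> * r = 2 * s / norm P" by (simp add: \<kappa> s_def P_def)
  have \<kappa>0: "0 < \<kappa> * r" using r P unfolding \<kappa>s by (simp add: s_def add_nonneg_pos)
  define R where "R = sqrt (\<kappa> * r)"
  have R: "0 < R" "R\<^sup>2 = \<kappa> * r" "R\<^sup>2 \<le> R"
    using \<kappa>0 small power_decreasing[of 1 2 R] by (auto simp: R_def)
  define W where "W y = {f. inner f (center P y) \<le> s}" for y
  have W: "W y \<in> sets borel" for y unfolding W_def by measurable
  have "measure (data_dist \<mu>) {p. fst p \<in> W (snd p)} \<le> 2 * 2 ^ DIM('a) * R ^ (DIM('a) + 1)"
  proof (rule measure_data_dist_le[OF W])
    fix y
    define u where "u = center P y /\<^sub>R norm P"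
    have u: "norm u = 1" using P by (simp add: u_def center_def)
    have uu: "inner u u = 1" using u by (simp add: dot_square_norm)
    have cu: "1 \<le> inner (center \<mu> y) u"
      using sep P by (simp add: u_def center_def field_simps)
    have "measure lborel (W y \<inter> cball (center \<mu> y) 1)
      \<le> 2 * measure lborel (cball (0::'a) 1) * 2 ^ DIM('a) * R ^ DIM('a) * (R\<^sup>2 / R)"
    \<comment> \<open>The centre \<open>center \<mu> y - u\<close> is the point of the ball nearest
      to the hyperplane. The window is twice the height of the cap, so its upper inequality is
      strict.\<close>
    proof (rule measure_slab_le[where u = u and z = "center \<mu> y - u" and c = "inner (center \<mu> y) u - 1"])
      have *: "norm (x - center \<mu> y + u) \<le> R \<and> inner (center \<mu> y) u - 1 \<le> inner x u
          \<and> inner x u < inner (center \<mu> y) u - 1 + R\<^sup>2"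
        if "x \<in> W y \<inter> cball (center \<mu> y) 1" for x
      proof -
        define d where "d = x - center \<mu> y"
        have d: "norm d \<le> 1" using that by (simp add: d_def dist_norm norm_minus_commute)
        have "inner x u \<le> s / norm P" using that P by (simp add: W_def u_def field_simps)
        then have x: "inner x u \<le> R\<^sup>2 / 2" unfolding R(2) \<kappa>s by simp
        then have du: "inner d u \<le> R\<^sup>2 / 2 - 1" using cu by (simp add: d_def inner_diff_left)
        have "(norm (d + u))\<^sup>2 = (norm d)\<^sup>2 + 2 * inner d u + 1"
          unfolding power2_norm_eq_inner inner_add_left inner_add_right uu inner_commute[of u d] by simp
        also have "\<dots> \<le> R\<^sup>2"
        proof -
          have "(norm d)\<^sup>2 \<le> 1" using d by (simp add: power_le_one)
          with du show ?thesis by linarith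
        qed
        finally have "norm (d + u) \<le> R" by (rule power2_le_imp_le) (use R(1) in simp)
        moreover have "- 1 \<le> inner d u"
          using Cauchy_Schwarz_ineq2[of d u] d u by simp
        moreover have "0 < R\<^sup>2" using R(1) by simp
        moreover from this du have "inner d u < R\<^sup>2 - 1" by linarith
        ultimately show ?thesis by (simp add: d_def inner_diff_left)
      qed
      show "W y \<inter> cball (center \<mu> y) 1 \<subseteq> cball (center \<mu> y - u) R"
      proof
        fix x assume "x \<in> W y \<inter> cball (center \<mu> y) 1"
        from *[OF this] have "norm (x - (center \<mu> y - u)) \<le> R" by (simp add: algebra_simps)
        then show "x \<in> cball (center \<mu> y - u) R" by (simp add: dist_norm norm_minus_commute)
      qed
      show "inner (center \<mu> y) u - 1 \<le> inner x u \<and> inner x u < inner (center \<mu> y) u - 1 + R\<^sup>2"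
        if "x \<in> W y \<inter> cball (center \<mu> y) 1" for x using *[OF that] by simp
    qed (use W u R(1,3) in auto)
    then show "measure lborel (W y \<inter> cball (center \<mu> y) 1)
      \<le> measure lborel (cball (0::'a) 1) * (2 * 2 ^ DIM('a) * R ^ (DIM('a) + 1))"
      using R(1) by (simp add: power2_eq_square mult_ac)
  qed
  moreover have "err (data_dist \<mu>) (h_post t w b k N F)
    \<le> measure (data_dist \<mu>) ({p. h_asym \<mu> w (fst p) \<noteq> snd p} \<union> {p. fst p \<in> W (snd p)})"
    unfolding err_def
  proof (rule data.finite_measure_mono_AE)
    show "AE p in data_dist \<mu>. p \<in> {p \<in> space (data_dist \<mu>). h_post t w b k N F (fst p) \<noteq> snd p} \<longrightarrow>
        p \<in> {p. h_asym \<mu> w (fst p) \<noteq> snd p} \<union> {p. fst p \<in> W (snd p)}"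
      using AE_data_dist
    proof eventually_elim
      case (elim p)
      show ?case
      proof (cases "4 * r * (norm \<mu> + 1) < \<bar>inner (fst p) (\<mu> + w)\<bar>")
        case True
        then show ?thesis
          using h_post_eq_h_asym[OF w good r norm_le_of_cball_center[OF elim]] by simp
      next
        case False
        then have "\<bar>inner (fst p) P\<bar> \<le> s" by (simp add: s_def P_def)
        then show ?thesis by (auto simp: W_def center_def)
      qed
    qed
    show "{p. h_asym \<mu> w (fst p) \<noteq> snd p} \<union> {p. fst p \<in> W (snd p)} \<in> sets (data_dist \<mu>)"
      using sets_h_asym_error data_dist_sum_labels(2)[of W, OF W] by auto
  qed
  moreover have "\<dots> \<le> measure (data_dist \<mu>) {p. h_asym \<mu> w (fst p) \<noteq> snd p} + measure (data_dist \<mu>) {p. fst p \<in> W (snd p)}"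
    using sets_h_asym_error data_dist_sum_labels(2)[of W, OF W] by (intro measure_Un_le) auto
  ultimately show ?thesis
    using zero by (simp add: err_def R_def)
qed

section \<open>Measurability and concentration\<close>

text \<open>Membership depends on the cardinality of a random index set, which is measurable because
  membership of each index is given by comparing measurable entropies.\<close>

lemma measurable_memory:
  fixes \<mu> w :: "'a::euclidean_space" and N :: nat
  defines "M \<equiv> PiM {..<N} (\<lambda>_. data_dist \<mu>)"
  shows "{S \<in> space M. j \<in> memory t w b k N (\<lambda>j. fst (S j)) y} \<in> sets M"
proof (cases "j < N")
  case True
  have F: "(\<lambda>S. fst (S i)) \<in> borel_measurable M" if "i < N" for i
  proof -
    have "fst \<in> data_dist \<mu> \<rightarrow>\<^sub>M borel" by measurable
    moreover have "(\<lambda>S. S i) \<in> M \<rightarrow>\<^sub>M data_dist \<mu>"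
      unfolding M_def using that by (intro measurable_component_singleton) auto
    ultimately show ?thesis by (rule measurable_compose[rotated])
  qed
  have z: "zpre w b \<in> borel_measurable borel" unfolding zpre_def by measurable
  have en: "entropy t w b \<in> borel_measurable borel"
    unfolding entropy_def phat1_def Let_def zpre_def by measurable
  have Z: "(\<lambda>S. zpre w b (fst (S i))) \<in> borel_measurable M" if "i < N" for i
    using measurable_compose[OF F[OF that] z] .
  have E: "(\<lambda>S. entropy t w b (fst (S i))) \<in> borel_measurable M" if "i < N" for i
    using measurable_compose[OF F[OF that] en] .
  have Y: "{S \<in> space M. yhat w b (fst (S i)) = y} \<in> sets M" if "i < N" for i
  proof -
    note [measurable] = Z[OF that]
    show ?thesis unfolding yhat_def by measurable
  qed
  define R where "R S = {i. i < N \<and> yhat w b (fst (S i)) = y \<and>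
        (entropy t w b (fst (S i)) < entropy t w b (fst (S j)) \<or>
         (entropy t w b (fst (S i)) = entropy t w b (fst (S j)) \<and> i < j))}" for S :: "nat \<Rightarrow> 'a \<times> bool"
  have R: "{S \<in> space M. i \<in> R S} \<in> sets M" for i
  proof (cases "i < N")
    case i: True
    note [measurable] = E[OF i] E[OF True]
    have "{S \<in> space M. entropy t w b (fst (S i)) < entropy t w b (fst (S j))} \<in> sets M"
      and "{S \<in> space M. entropy t w b (fst (S i)) = entropy t w b (fst (S j))} \<in> sets M"
      by measurable
    from sets.sets_Collect_disj[OF sets.sets_Collect_conj[OF sets.sets_Collect_const[of M "i < j"] this(2)] this(1)]
    have "{S \<in> space M. (entropy t w b (fst (S i)) < entropy t w b (fst (S j)) \<or>
         (entropy t w b (fst (S i)) = entropy t w b (fst (S j)) \<and> i < j))} \<in> sets M" .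
    from sets.sets_Collect_conj[OF this Y[OF i]] show ?thesis using i by (simp add: R_def)
  qed (simp add: R_def)
  note [measurable] = measurable_card[OF R]
  have "{S \<in> space M. card (R S) < k} \<in> sets M" by measurable
  from sets.sets_Collect_conj[OF this Y[OF True]] show ?thesis using True by (simp add: memory_def R_def)
qed (simp add: memory_def)

text \<open>The error is the measure of a section of an event in the product of the sample space and
  the data space. That event is jointly measurable since the quantifiers over the memory reduce to
  finite ones over indices below \<open>N\<close>.\<close>

lemma borel_measurable_err_h_post:
  fixes \<mu> w :: "'a::euclidean_space" and N :: nat
  defines "M \<equiv> PiM {..<N} (\<lambda>_. data_dist \<mu>)"
  shows "(\<lambda>S. err (data_dist \<mu>) (h_post t w b k N (\<lambda>j. fst (S j)))) \<in> borel_measurable M"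
proof -
  let ?Q = "M \<Otimes>\<^sub>M data_dist \<mu>"
  have mem: "{x \<in> space ?Q. j \<in> memory t w b k N (\<lambda>j. fst (fst x j)) y} \<in> sets ?Q" for j y
  proof -
    have "fst -` {S \<in> space M. j \<in> memory t w b k N (\<lambda>j. fst (S j)) y} \<inter> space ?Q \<in> sets ?Q"
      unfolding M_def by (rule measurable_sets[OF measurable_fst measurable_memory])
    moreover have "fst -` {S \<in> space M. j \<in> memory t w b k N (\<lambda>j. fst (S j)) y} \<inter> space ?Q
      = {x \<in> space ?Q. j \<in> memory t w b k N (\<lambda>j. fst (fst x j)) y}"
      by (auto simp: space_pair_measure)
    ultimately show ?thesis by simp
  qed
  have f: "(\<lambda>x. fst (snd x)) \<in> borel_measurable ?Q" by measurable
  have F: "(\<lambda>x. fst (fst x i)) \<in> borel_measurable ?Q" if "i \<in> {..<N}" for i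
  proof -
    have "fst \<in> data_dist \<mu> \<rightarrow>\<^sub>M borel" by measurable
    moreover have "(\<lambda>x. fst x i) \<in> ?Q \<rightarrow>\<^sub>M data_dist \<mu>"
      unfolding M_def using that by (intro measurable_compose[OF measurable_fst measurable_component_singleton])
    ultimately show ?thesis by (rule measurable_compose[rotated])
  qed
  have d: "{x \<in> space ?Q. dist (fst (snd x)) (fst (fst x j)) < dist (fst (snd x)) (fst (fst x i))} \<in> sets ?Q"
    if "i \<in> {..<N}" "j \<in> {..<N}" for i j
  proof -
    note [measurable] = f F[OF that(1)] F[OF that(2)]
    show ?thesis by measurable
  qed
  have "{x \<in> space ?Q. \<exists>j\<in>{..<N}. j \<in> memory t w b k N (\<lambda>j. fst (fst x j)) True \<and>
     (\<forall>i\<in>{..<N}. i \<in> memory t w b k N (\<lambda>j. fst (fst x j)) False \<longrightarrow>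
        dist (fst (snd x)) (fst (fst x j)) < dist (fst (snd x)) (fst (fst x i)))} \<in> sets ?Q"
  proof (intro sets.sets_Collect_finite_Ex finite_lessThan sets.sets_Collect_conj mem)
    fix j assume j: "j \<in> {..<N}"
    show "{x \<in> space ?Q. \<forall>i\<in>{..<N}. i \<in> memory t w b k N (\<lambda>j. fst (fst x j)) False \<longrightarrow>
        dist (fst (snd x)) (fst (fst x j)) < dist (fst (snd x)) (fst (fst x i))} \<in> sets ?Q"
      by (intro sets.sets_Collect_finite_All finite_lessThan sets.sets_Collect_imp mem d j)
  qed
  moreover have "h_post t w b k N F f \<longleftrightarrow> (\<exists>j\<in>{..<N}. j \<in> memory t w b k N F True \<and>
     (\<forall>i\<in>{..<N}. i \<in> memory t w b k N F False \<longrightarrow> dist f (F j) < dist f (F i)))" for F and f :: 'a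
    by (auto simp: h_post_def memory_def)
  ultimately have [measurable]:
    "{x \<in> space ?Q. h_post t w b k N (\<lambda>j. fst (fst x j)) (fst (snd x))} \<in> sets ?Q" by simp
  have "{x \<in> space ?Q. h_post t w b k N (\<lambda>j. fst (fst x j)) (fst (snd x)) \<noteq> snd (snd x)} \<in> sets ?Q"
    by measurable
  then show ?thesis unfolding err_def
    by (intro data.measurable_measure) (auto simp: space_pair_measure)
qed

text \<open>It suffices that, for each class, the cap of height r^2 at the tip receives k samples.\<close>
lemma prob_good_memory:
  fixes \<mu> w :: "'a::euclidean_space"
  assumes w: "norm w = 1" and t: "0 < t" and k: "1 \<le> k" and r: "0 < r" "r \<le> 1/2"
    and rm: "r\<^sup>2 \<le> 2 * inner \<mu> w" "r\<^sup>2 < inner \<mu> w + 1 + b" "r\<^sup>2 < inner \<mu> w + 1 - b"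
    and \<delta>: "0 < \<delta>" "\<delta> < 1"
    and N: "4 * (real k + ln (1 / \<delta>)) \<le> real N * (r ^ (DIM('a) + 1) / (14 * 2 ^ DIM('a)))"
    and E: "E \<in> sets (PiM {..<N} (\<lambda>_. data_dist \<mu>))"
    and good: "\<And>S. S \<in> space (PiM {..<N} (\<lambda>_. data_dist \<mu>)) \<Longrightarrow>
      good_memory t w b k N (\<mu> + w) (2 * r) (\<lambda>j. fst (S j)) \<Longrightarrow> S \<in> E"
  shows "1 - \<delta> \<le> measure (PiM {..<N} (\<lambda>_. data_dist \<mu>)) E"
proof -
  let ?P = "PiM {..<N} (\<lambda>_. data_dist \<mu>)"
  define C where "C y = tip_cap \<mu> w r y \<times> {y}" for y
  have capm: "tip_cap \<mu> w r y \<in> sets borel" for y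
    unfolding tip_cap_def by measurable
  have C: "C y \<in> sets (data_dist \<mu>)" for y
    using capm by (auto simp: C_def sets_data_dist)
  \<comment> \<open>The constant 14 is the 7 of the cap estimate times 2 for the prior of the
    label.\<close>
  have mC: "r ^ (DIM('a) + 1) / (14 * 2 ^ DIM('a)) \<le> measure (data_dist \<mu>) (C y)" for y
  proof -
    define G where "G = {x. norm x \<le> 1 \<and> inner x (center w y) > 1 - r\<^sup>2}"
    have G: "G \<in> sets borel" unfolding G_def by measurable
    have "tip_cap \<mu> w r y \<inter> cball (center \<mu> y) 1 = (+) (center \<mu> y) ` G"
    proof (intro equalityI subsetI)
      fix x assume "x \<in> tip_cap \<mu> w r y \<inter> cball (center \<mu> y) 1"
      then show "x \<in> (+) (center \<mu> y) ` G"
        by (intro image_eqI[of _ _ "x - center \<mu> y"]) (auto simp: G_def tip_cap_def)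
    qed (auto simp: G_def tip_cap_def dist_norm)
    then have "measure lborel (tip_cap \<mu> w r y \<inter> cball (center \<mu> y) 1) = measure lborel G"
      using measure_lborel_translation(1)[OF G] by simp
    also have "\<dots> \<ge> measure lborel (cball (0::'a) 1) / (7 * 2 ^ DIM('a)) * r ^ (DIM('a) + 1)"
      unfolding G_def using w r by (intro measure_cap_ge) (auto simp: center_def)
    finally show ?thesis
      unfolding C_def measure_data_dist[OF capm] using measure_cball_pos[where 'a='a]
      by (simp add: field_simps)
  qed
  define B where "B y = {S \<in> space ?P. card {i. i < N \<and> S i \<in> C y} < k}" for y
  have Bm: "B y \<in> sets ?P" for y
  proof -
    have "{S \<in> space ?P. i \<in> {i. i < N \<and> S i \<in> C y}} \<in> sets ?P" for i
    proof (cases "i < N")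
      case True
      then have "(\<lambda>S. S i) \<in> ?P \<rightarrow>\<^sub>M data_dist \<mu>"
        by (intro measurable_component_singleton) simp
      from measurable_sets[OF this C] have "(\<lambda>S. S i) -` C y \<inter> space ?P \<in> sets ?P" .
      moreover have "(\<lambda>S. S i) -` C y \<inter> space ?P = {S \<in> space ?P. i \<in> {i. i < N \<and> S i \<in> C y}}"
        using True by blast
      ultimately show ?thesis by (simp only:)
    qed simp
    note card = measurable_card[OF this]
    have "{..<k} \<in> sets (count_space UNIV)" by simp
    from measurable_sets[OF card this]
    have "(\<lambda>S. card {i. i < N \<and> S i \<in> C y}) -` {..<k} \<inter> space ?P \<in> sets ?P" .
    moreover have "(\<lambda>S. card {i. i < N \<and> S i \<in> C y}) -` {..<k} \<inter> space ?P = B y"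
      unfolding B_def by blast
    ultimately show ?thesis by (simp only:)
  qed
  \<comment> \<open>By \<open>N\<close> the Chernoff exponent is at most
    \<open>- real k - 2 * ln (1 / \<delta>)\<close>; as \<open>k\<close> is at least 1, the first
    term pays for the \<open>ln 2\<close> needed to split \<open>\<delta>\<close> between the two
    classes.\<close>
  have PB: "measure ?P (B y) \<le> \<delta> / 2" for y
  proof -
    have "4 * (real k + ln (1 / \<delta>)) \<le> real N * measure (data_dist \<mu>) (C y)"
      using N mult_left_mono[OF mC[of y], of "real N"] by simp
    moreover have "ln 2 \<le> real k" using ln_less_self[of "2::real"] ln_2_less_1 k by simp
    moreover have "0 < ln (1 / \<delta>)" using \<delta> by (intro ln_gt_zero) simp
    ultimately have "real k - real N * measure (data_dist \<mu>) (C y) / 2 \<le> - (ln 2 + ln (1 / \<delta>))"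
      by simp
    also have "\<dots> = ln (\<delta> / 2)" using \<delta> by (simp add: ln_div)
    finally have "exp (real k - real N * measure (data_dist \<mu>) (C y) / 2) \<le> \<delta> / 2"
      using \<delta> by (simp add: ln_ge_iff)
    with prob_few_samples_le[OF prob_space_data_dist C[of y], of N k] show ?thesis by (simp add: B_def)
  qed
  have "measure ?P (B True \<union> B False) \<le> \<delta>"
    using measure_Un_le[OF Bm[of True] Bm[of False]] PB[of True] PB[of False] by simp
  then have "1 - \<delta> \<le> measure ?P (space ?P - (B True \<union> B False))"
    using Bm by (subst sample.prob_compl) auto
  also have "\<dots> \<le> measure ?P E"
  proof (rule sample.finite_measure_mono_AE[OF _ E])
    have "AE S in ?P. \<forall>i\<in>{..<N}. fst (S i) \<in> cball (center \<mu> (snd (S i))) 1"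
      by (intro AE_finite_allI AE_PiM_component prob_space_data_dist AE_data_dist) auto
    then show "AE S in ?P. S \<in> space ?P - (B True \<union> B False) \<longrightarrow> S \<in> E"
    proof eventually_elim
      case (elim S)
      show ?case
      proof
        assume S: "S \<in> space ?P - (B True \<union> B False)"
        then have Sp: "S \<in> space ?P" by simp
        have nB: "\<not> card {i. i < N \<and> S i \<in> C y} < k" for y
          using S by (cases y) (auto simp: B_def)
        show "S \<in> E"
        proof (rule good[OF Sp], rule good_memoryI[OF w t k r(1) rm])
          show "\<exists>y. fst (S i) \<in> cball (center \<mu> y) 1" if "i < N" for i
            using elim that by blast
          fix y
          have "k \<le> card {i. i < N \<and> S i \<in> C y}" using nB[of y] by simp
          also have "\<dots> \<le> card {i. i < N \<and> fst (S i) \<in> tip_cap \<mu> w r y}"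
            by (intro card_mono) (auto simp: C_def)
          finally show "k \<le> card {i. i < N \<and> fst (S i) \<in> tip_cap \<mu> w r y}" .
        qed
      qed
    qed
  qed
  finally show ?thesis .
qed

section \<open>From the radius to the rate in N\<close>

text \<open>Both claims choose \<open>r ^ (DIM('a) + 1)\<close> proportional to
  \<open>(k + ln (1 / \<delta>)) / N\<close> and differ only in the power \<open>e\<close> of this
  quantity that bounds the excess error over \<open>\<beta>\<close>.\<close>

lemma rate_of_good_memory:
  fixes \<mu> w :: "'a::euclidean_space"
  assumes w: "norm w = 1" and t: "0 < t"
    and m: "inner \<mu> w > 0" "- inner \<mu> w - 1 < b" "b < inner \<mu> w + 1"
    and \<rho>: "0 < \<rho>" and A: "0 < A"
    and bound: "\<And>k N r F. 0 < r \<Longrightarrow> r \<le> \<rho> \<Longrightarrow> good_memory t w b k N (\<mu> + w) (2 * r) F \<Longrightarrow>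
      err (data_dist \<mu>) (h_post t w b k N F) \<le> \<beta> + A * (r ^ (DIM('a) + 1)) powr e"
  shows "\<exists>C>0. \<forall>k::nat. k \<ge> 1 \<longrightarrow> (\<forall>\<delta>::real. 0 < \<delta> \<and> \<delta> < 1 \<longrightarrow>
            (\<exists>N0::nat. \<forall>N\<ge>N0.
               measure (PiM {..<N} (\<lambda>_. data_dist \<mu>))
                 {S \<in> space (PiM {..<N} (\<lambda>_. data_dist \<mu>)).
                    err (data_dist \<mu>) (h_post t w b k N (\<lambda>j. fst (S j)))
                      \<le> \<beta> + C * ((real k + ln (1 / \<delta>)) / real N) powr e}
               \<ge> 1 - \<delta>))"
proof -
  define n where "n = DIM('a) + 1"
  define a where "a = 4 * (14 * 2 ^ DIM('a) :: real)"
  have a: "0 < a" by (simp add: a_def)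
  \<comment> \<open>A common bound for the square of \<open>r\<close>; the halves make two of the
    conditions strict, and 1 gives \<open>r \<le> 1/2\<close> through
    \<open>\<rho>' \<le> \<eta> / 2\<close>.\<close>
  define \<eta> where "\<eta> = Min {2 * inner \<mu> w, (inner \<mu> w + 1 + b) / 2, (inner \<mu> w + 1 - b) / 2, 1}"
  have \<eta>: "0 < \<eta>" "\<eta> \<le> 2 * inner \<mu> w" "\<eta> < inner \<mu> w + 1 + b" "\<eta> < inner \<mu> w + 1 - b" "\<eta> \<le> 1"
  proof -
    have "\<eta> \<le> 2 * inner \<mu> w" "\<eta> \<le> (inner \<mu> w + 1 + b) / 2" "\<eta> \<le> (inner \<mu> w + 1 - b) / 2" "\<eta> \<le> 1"
      unfolding \<eta>_def by (rule Min_le; simp)+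
    then show "\<eta> \<le> 2 * inner \<mu> w" "\<eta> < inner \<mu> w + 1 + b" "\<eta> < inner \<mu> w + 1 - b" "\<eta> \<le> 1"
      using m by auto
    show "0 < \<eta>" using m by (auto simp: \<eta>_def)
  qed
  define \<rho>' where "\<rho>' = min \<rho> (\<eta> / 2)"
  have \<rho>': "0 < \<rho>'" "\<rho>' \<le> \<rho>" "\<rho>' \<le> \<eta> / 2" using \<rho> \<eta> by (auto simp: \<rho>'_def)
  define C where "C = A * a powr e"
  have "0 < C" using A a by (simp add: C_def)
  moreover have "\<exists>N0::nat. \<forall>N\<ge>N0. 1 - \<delta> \<le> measure (PiM {..<N} (\<lambda>_. data_dist \<mu>))
       {S \<in> space (PiM {..<N} (\<lambda>_. data_dist \<mu>)). err (data_dist \<mu>) (h_post t w b k N (\<lambda>j. fst (S j)))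
          \<le> \<beta> + C * ((real k + ln (1 / \<delta>)) / real N) powr e}"
    if k: "1 \<le> k" and \<delta>: "0 < \<delta>" "\<delta> < 1" for k :: nat and \<delta> :: real
  proof -
    define L where "L = real k + ln (1 / \<delta>)"
    have "0 < ln (1 / \<delta>)" using \<delta> by (intro ln_gt_zero) simp
    then have L: "0 < L" using k by (simp add: L_def)
    \<comment> \<open>From here on the radius \<open>root n q\<close> is at most
      \<open>\<rho>'\<close>. Only this threshold depends on \<open>k\<close> and
      \<open>\<delta>\<close>; the constant \<open>C\<close> is already fixed.\<close>
    define N0 where "N0 = nat \<lceil>a * L / \<rho>' ^ n\<rceil>"
    have "1 - \<delta> \<le> measure (PiM {..<N} (\<lambda>_. data_dist \<mu>))
       {S \<in> space (PiM {..<N} (\<lambda>_. data_dist \<mu>)). err (data_dist \<mu>) (h_post t w b k N (\<lambda>j. fst (S j)))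
          \<le> \<beta> + C * (L / real N) powr e}" (is "_ \<le> measure ?P ?E")
      if N: "N0 \<le> N" for N
    proof -
      have N1: "a * L / \<rho>' ^ n \<le> real N" using N unfolding N0_def by linarith
      have "0 < a * L / \<rho>' ^ n" using a L \<rho>' by simp
      with N1 have N2: "0 < real N" by linarith
      define q where "q = a * L / real N"
      have q: "0 < q" "q \<le> \<rho>' ^ n" using N1 N2 a L \<rho>' by (auto simp: q_def field_simps)
      define r where "r = root n q"
      have rn: "r ^ n = q" unfolding r_def by (rule real_root_pow_pos2) (use q in \<open>simp_all add: n_def\<close>)
      have r: "0 < r" "r \<le> \<rho>'"
      proof -
        show "0 < r" using q by (simp add: r_def n_def)
        have "r \<le> root n (\<rho>' ^ n)" unfolding r_def using q by (simp add: n_def)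
        also have "\<dots> = \<rho>'" using \<rho>'(1) by (intro real_root_power_cancel) (simp_all add: n_def)
        finally show "r \<le> \<rho>'" .
      qed
      have "r\<^sup>2 \<le> 1 * r" unfolding power2_eq_square using r \<rho>' \<eta> by (intro mult_right_mono) auto
      then have r2: "r\<^sup>2 < \<eta>" using r \<rho>' \<eta> by linarith
      show ?thesis
      proof (rule prob_good_memory[OF w t k r(1) _ _ _ _ \<delta>])
        show "r \<le> 1/2" using r \<rho>' \<eta> by linarith
        show "4 * (real k + ln (1 / \<delta>)) \<le> real N * (r ^ (DIM('a) + 1) / (14 * 2 ^ DIM('a)))"
          using N2 unfolding n_def[symmetric] rn q_def L_def[symmetric] by (simp add: a_def)
        show "?E \<in> sets ?P"
          by (rule borel_measurable_le[OF borel_measurable_err_h_post borel_measurable_const])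
        fix S assume "S \<in> space ?P" and g: "good_memory t w b k N (\<mu> + w) (2 * r) (\<lambda>j. fst (S j))"
        moreover have "err (data_dist \<mu>) (h_post t w b k N (\<lambda>j. fst (S j))) \<le> \<beta> + A * q powr e"
          using bound[OF r(1) order_trans[OF r(2) \<rho>'(2)] g] unfolding n_def[symmetric] rn .
        moreover have "A * q powr e = C * (L / real N) powr e"
          using a L N2 by (simp add: q_def C_def powr_mult flip: times_divide_eq_right)
        ultimately show "S \<in> ?E" by simp
      qed (use r2 \<eta> in auto)
    qed
    then show ?thesis unfolding L_def by blast
  qed
  ultimately show ?thesis by blast
qed

theorem theorem1:
  fixes \<mu> w :: "'a::euclidean_space" and b t :: real
  assumes "norm w = 1" and "t > 0"
    and "inner \<mu> w > 0" and "- inner \<mu> w - 1 < b" and "b < inner \<mu> w + 1"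
  shows "(\<exists>C>0. \<forall>k::nat. k \<ge> 1 \<longrightarrow> (\<forall>\<delta>::real. 0 < \<delta> \<and> \<delta> < 1 \<longrightarrow>
            (\<exists>N0::nat. \<forall>N\<ge>N0.
               measure (PiM {..<N} (\<lambda>_. data_dist \<mu>))
                 {S \<in> space (PiM {..<N} (\<lambda>_. data_dist \<mu>)).
                    err (data_dist \<mu>) (h_post t w b k N (\<lambda>j. fst (S j)))
                      \<le> err (data_dist \<mu>) (h_asym \<mu> w)
                         + C * ((real k + ln (1 / \<delta>)) / real N) powr (1 / (real DIM('a) + 1))}
               \<ge> 1 - \<delta>)))
       \<and> (err (data_dist \<mu>) (h_asym \<mu> w) = 0 \<longrightarrow>
          (\<exists>C>0. \<forall>k::nat. k \<ge> 1 \<longrightarrow> (\<forall>\<delta>::real. 0 < \<delta> \<and> \<delta> < 1 \<longrightarrow>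
            (\<exists>N0::nat. \<forall>N\<ge>N0.
               measure (PiM {..<N} (\<lambda>_. data_dist \<mu>))
                 {S \<in> space (PiM {..<N} (\<lambda>_. data_dist \<mu>)).
                    err (data_dist \<mu>) (h_post t w b k N (\<lambda>j. fst (S j)))
                      \<le> C * ((real k + ln (1 / \<delta>)) / real N) powr (1 / 2)}
               \<ge> 1 - \<delta>))))"
proof (intro conjI impI)
  have "inner w w = 1" using assms(1) by (simp add: dot_square_norm)
  then have "inner (\<mu> + w) w > 0" using assms(3) by (simp add: inner_add_left)
  then have "\<mu> + w \<noteq> 0" by auto
  then have P: "0 < norm (\<mu> + w)" by simp
  have m1: "0 < norm \<mu> + 1" by (simp add: add_nonneg_pos)
  define \<tau> where "\<tau> = 12 * (norm \<mu> + 1) / norm (\<mu> + w)"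
  have \<tau>: "0 < \<tau>" using P m1 by (simp add: \<tau>_def)
  show "\<exists>C>0. \<forall>k::nat. k \<ge> 1 \<longrightarrow> (\<forall>\<delta>::real. 0 < \<delta> \<and> \<delta> < 1 \<longrightarrow>
            (\<exists>N0::nat. \<forall>N\<ge>N0.
               measure (PiM {..<N} (\<lambda>_. data_dist \<mu>))
                 {S \<in> space (PiM {..<N} (\<lambda>_. data_dist \<mu>)).
                    err (data_dist \<mu>) (h_post t w b k N (\<lambda>j. fst (S j)))
                      \<le> err (data_dist \<mu>) (h_asym \<mu> w)
                         + C * ((real k + ln (1 / \<delta>)) / real N) powr (1 / (real DIM('a) + 1))}
               \<ge> 1 - \<delta>))"
  \<comment> \<open>The excess error is linear in \<open>r\<close>, which is
    \<open>r ^ (DIM('a) + 1)\<close> to the power \<open>1 / (DIM('a) + 1)\<close>.\<close>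
  proof (rule rate_of_good_memory[OF assms, where \<rho> = "1 / \<tau>" and A = "2 * 2 ^ DIM('a) * \<tau>"])
    fix k N r and F :: "nat \<Rightarrow> 'a"
    assume r: "0 < r" "r \<le> 1 / \<tau>" and g: "good_memory t w b k N (\<mu> + w) (2 * r) F"
    have "(r ^ (DIM('a) + 1)) powr (1 / (real DIM('a) + 1)) = r"
    proof -
      have "r ^ (DIM('a) + 1) = r powr (real DIM('a) + 1)"
        using powr_realpow[OF r(1), of "DIM('a) + 1"] by (simp add: add.commute)
      then have "(r ^ (DIM('a) + 1)) powr (1 / (real DIM('a) + 1))
        = r powr ((real DIM('a) + 1) * (1 / (real DIM('a) + 1)))"
        by (simp only: powr_powr)
      also have "(real DIM('a) + 1) * (1 / (real DIM('a) + 1)) = 1"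
        by (simp add: add_nonneg_eq_0_iff)
      finally show ?thesis using r by simp
    qed
    moreover have "12 * (norm \<mu> + 1) / norm (\<mu> + w) * r \<le> 1"
      using r \<tau> unfolding \<tau>_def[symmetric] by (simp add: field_simps)
    ultimately show "err (data_dist \<mu>) (h_post t w b k N F) \<le> err (data_dist \<mu>) (h_asym \<mu> w)
        + 2 * 2 ^ DIM('a) * \<tau> * (r ^ (DIM('a) + 1)) powr (1 / (real DIM('a) + 1))"
      using err_le_err_asym_plus[OF assms(1,3) g r(1)] unfolding \<tau>_def by simp
  qed (use \<tau> in auto)
  assume zero: "err (data_dist \<mu>) (h_asym \<mu> w) = 0"
  define \<kappa> where "\<kappa> = 8 * (norm \<mu> + 1) / norm (\<mu> + w)"
  have \<kappa>: "0 < \<kappa>" using P m1 by (simp add: \<kappa>_def)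
  have "\<exists>C>0. \<forall>k::nat. k \<ge> 1 \<longrightarrow> (\<forall>\<delta>::real. 0 < \<delta> \<and> \<delta> < 1 \<longrightarrow>
            (\<exists>N0::nat. \<forall>N\<ge>N0.
               measure (PiM {..<N} (\<lambda>_. data_dist \<mu>))
                 {S \<in> space (PiM {..<N} (\<lambda>_. data_dist \<mu>)).
                    err (data_dist \<mu>) (h_post t w b k N (\<lambda>j. fst (S j)))
                      \<le> 0 + C * ((real k + ln (1 / \<delta>)) / real N) powr (1 / 2)}
               \<ge> 1 - \<delta>))"
  \<comment> \<open>The caps have mass of order \<open>sqrt r ^ (DIM('a) + 1)\<close>, the square
    root of \<open>r ^ (DIM('a) + 1)\<close>; so the dimension cancels from the exponent of the
    rate.\<close>
  proof (rule rate_of_good_memory[OF assms, where \<rho> = "1 / \<kappa>"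
      and A = "2 * 2 ^ DIM('a) * sqrt \<kappa> ^ (DIM('a) + 1)"])
    fix k N r and F :: "nat \<Rightarrow> 'a"
    assume r: "0 < r" "r \<le> 1 / \<kappa>" and g: "good_memory t w b k N (\<mu> + w) (2 * r) F"
    have "\<kappa> * r \<le> 1" using r \<kappa> by (simp add: field_simps)
    moreover have "sqrt (\<kappa> * r) ^ (DIM('a) + 1)
        = sqrt \<kappa> ^ (DIM('a) + 1) * (r ^ (DIM('a) + 1)) powr (1 / 2)"
      using r by (simp add: powr_half_sqrt real_sqrt_mult real_sqrt_power power_mult_distrib)
    ultimately show "err (data_dist \<mu>) (h_post t w b k N F)
      \<le> 0 + 2 * 2 ^ DIM('a) * sqrt \<kappa> ^ (DIM('a) + 1) * (r ^ (DIM('a) + 1)) powr (1 / 2)"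
      using err_le_of_err_asym_zero[OF assms(1,3) g r(1) zero \<kappa>_def] by (simp add: mult_ac)
  qed (use \<kappa> in auto)
  then show "\<exists>C>0. \<forall>k::nat. k \<ge> 1 \<longrightarrow> (\<forall>\<delta>::real. 0 < \<delta> \<and> \<delta> < 1 \<longrightarrow>
            (\<exists>N0::nat. \<forall>N\<ge>N0.
               measure (PiM {..<N} (\<lambda>_. data_dist \<mu>))
                 {S \<in> space (PiM {..<N} (\<lambda>_. data_dist \<mu>)).
                    err (data_dist \<mu>) (h_post t w b k N (\<lambda>j. fst (S j)))
                      \<le> C * ((real k + ln (1 / \<delta>)) / real N) powr (1 / 2)}
               \<ge> 1 - \<delta>))"
    by simp
qed

end
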